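(* Let $n\ge2$ and let $\mu\in\{\mu_1,\mu_2\}$, where $\mu_1=(1^{(n)},0^{(n)})$ and $\mu_2=(1^{(n-1)},0,1,0^{(n-1)})$. Then $\mathrm{Perm}^{\mathrm{sp}}(\mu)=\mathrm{Perm}(\mu)$ as subsets of the Iwahori–Weyl group $\widetilde W$ of $GO_{2n}$.
   Context: $i^*:=2n+1-i$ for $i\in\{1,\dots,2n\}$; $(a^{(r)},b^{(s)},\dots)$ is the tuple with $a$ repeated $r$ times, then $b$ repeated $s$ times, etc. $X_*(T)=\{(r_1,\dots,r_{2n})\in\mathbb Z^{2n}: r_1+r_{2n}=r_2+r_{2n-1}=\dots=r_n+r_{n+1}\}$; $W=\{\sigma\in S_{2n}:\sigma(i^* )=\sigma(i)^*\ \forall i\}$, and $W^\circ\subset W$ is the index-2 subgroup of permutations even in $S_{2n}$. The Iwahori–Weyl group of $GO_{2n}$ is $\widetilde W=X_*(T)\rtimes W$; $t_\mu\in\widetilde W$ is the element given by $\mu\in X_*(T)$. $\widetilde W$ acts on $\mathbb Z^{2n}$ and on $X_*(T)\otimes\mathbb R$, with $t_\mu$ acting as translation by $\mu$ and $W$ permuting coordinates ($(\sigma x)_{\sigma(i)}=x_i$). $Q^\vee$ is the set of $r\in\mathbb Z^{2n}$ with $r_i+r_{i^*}=0$ for all $i$ and $r_1+\dots+r_n$ even; $W_{\mathrm a}=Q^\vee\rtimes W^\circ$, a normal subgroup of $\widetilde W$. **$\mu$-permissible set.** Let $\widetilde A=\{x\in X_*(T)\otimes\mathbb R: -1<x_i-x_j<0\text{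 for all } i<j,\ j\ne i^*\}$ (the inverse image in $X_*(T)\otimes\mathbb R$ of the base alcove). $\mathrm{Perm}(\mu)$ is the set of $w\in\widetilde W$ such that $w\equiv t_\mu\bmod W_{\mathrm a}$ and $wx-x\in\mathrm{Conv}(W^\circ\mu)$ for all $x\in\widetilde A$, where $\mathrm{Conv}(W^\circ\mu)$ is the convex hull in $X_*(T)\otimes\mathbb R$ of the $W^\circ$-orbit of $\mu$. **$\mu$-spin-permissible set.** Let $\omega_i=((-1)^{(i)},0^{(2n-i)})$ for $0\le i\le 2n-1$. For $w\in\widetilde W$ put $v_i=w\omega_i\in\mathbb Z^{2n}$ and $\mu_i^w=v_i-\omega_i$. $w$ is $GL$-permissible if $\omega_i\le v_i\le\omega_i+(1,\dots,1)$ entrywise for all $0\le i\le2n-1$ and the sum of the entries of $v_0$ is $n$. Then $\mu_i^w$ is called totally isotropic if $\mu^w_i(j)=1-\mu^w_i(j^* )$ for all $j$. $\mathrm{Perm}^{\mathrm{sp}}(\mu)$ is the set of $GL$-permissible $w\in\widetilde W$ such that $\mu_i^w\in W^\circ\mu$ for every $0\le i\le n$ with $\mu_i^w$ totally isotropic. *)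

theory Defs
  imports
    "HOL-Analysis.Analysis"
    "HOL-Combinatorics.Permutations"
    "HOL-Library.Function_Algebras"
    "HOL-Algebra.Coset"
begin

(* Vectors with coordinates indexed by 1, ..., 2n are functions on nat that vanish
   outside {1..2n}; addition and subtraction are pointwise. *)

instantiation "fun" :: (type, real_vector) real_vector
begin

definition scaleR_fun :: "real \<Rightarrow> ('a \<Rightarrow> 'b) \<Rightarrow> 'a \<Rightarrow> 'b" where
  "scaleR_fun c f = (\<lambda>x. c *\<^sub>R f x)"

instance
  by standard (simp_all add: scaleR_fun_def fun_eq_iff scaleR_add_right scaleR_add_left)

end

definition star :: "nat \<Rightarrow> nat \<Rightarrow> nat" where
  "star n i = 2 * n + 1 - i"

definition vecs :: "nat \<Rightarrow> (nat \<Rightarrow> 'a::zero) set" where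
  "vecs n = {x. \<forall>j. j \<notin> {1..2*n} \<longrightarrow> x j = 0}"

(* For 'a = int this is X_*(T), for 'a = real it is X_*(T) tensored with the reals. *)
definition cochars :: "nat \<Rightarrow> (nat \<Rightarrow> 'a::ring_1) set" where
  "cochars n = {x \<in> vecs n. \<exists>c. \<forall>i\<in>{1..n}. x i + x (star n i) = c}"

definition weyl :: "nat \<Rightarrow> (nat \<Rightarrow> nat) set" where
  "weyl n = {\<sigma>. \<sigma> permutes {1..2*n} \<and> (\<forall>i\<in>{1..2*n}. \<sigma> (star n i) = star n (\<sigma> i))}"

definition weyl0 :: "nat \<Rightarrow> (nat \<Rightarrow> nat) set" where
  "weyl0 n = {\<sigma> \<in> weyl n. evenperm \<sigma>}"

(* (\<sigma> x)(\<sigma> i) = x i *)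
definition perm_act :: "(nat \<Rightarrow> nat) \<Rightarrow> (nat \<Rightarrow> 'a) \<Rightarrow> nat \<Rightarrow> 'a" where
  "perm_act \<sigma> x = (\<lambda>j. x (inv_into UNIV \<sigma> j))"

type_synonym iw = "(nat \<Rightarrow> int) \<times> (nat \<Rightarrow> nat)"

(* The pair (r, \<sigma>) stands for t_r \<sigma>. *)
definition iw_group :: "nat \<Rightarrow> iw monoid" where
  "iw_group n =
    \<lparr>carrier = cochars n \<times> weyl n,
     monoid.mult = (\<lambda>(r, \<sigma>) (s, \<tau>). (r + perm_act \<sigma> s, \<sigma> \<circ> \<tau>)),
     one = (0, id)\<rparr>"

definition transl :: "(nat \<Rightarrow> int) \<Rightarrow> iw" where
  "transl \<mu> = (\<mu>, id)"

lemma perm_act_simps: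
  "perm_act id x = x" "perm_act \<sigma> (0 :: nat \<Rightarrow> 'a::zero) = 0"
  "perm_act \<sigma> (y + z) = perm_act \<sigma> y + perm_act \<sigma> (z :: nat \<Rightarrow> 'b::plus)"
  "bij \<sigma> \<Longrightarrow> bij \<tau> \<Longrightarrow> perm_act \<sigma> (perm_act \<tau> x) = perm_act (\<sigma> \<circ> \<tau>) x"
  by (auto simp: perm_act_def fun_eq_iff o_inv_distrib inv_id)

lemma star_in: "i \<in> {1..2*n} \<Longrightarrow> star n i \<in> {1..2*n}"
  by (auto simp: star_def)

lemma star_star: "i \<in> {1..2*n} \<Longrightarrow> star n (star n i) = i"
  by (auto simp: star_def)

lemma cochars_iff:
  "(x :: nat \<Rightarrow> 'a::ring_1) \<in> cochars n \<longleftrightarrow>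
     x \<in> vecs n \<and> (\<exists>c. \<forall>i\<in>{1..2*n}. x i + x (star n i) = c)"
proof -
  have "(\<forall>i\<in>{1..n}. x i + x (star n i) = c) \<longleftrightarrow> (\<forall>i\<in>{1..2*n}. x i + x (star n i) = c)" for c
  proof
    assume h: "\<forall>i\<in>{1..n}. x i + x (star n i) = c"
    show "\<forall>i\<in>{1..2*n}. x i + x (star n i) = c"
    proof
      fix i assume i: "i \<in> {1..2*n}"
      show "x i + x (star n i) = c"
      proof (cases "i \<le> n")
        case False
        then have "star n i \<in> {1..n}" using i by (auto simp: star_def)
        with h have "x (star n i) + x (star n (star n i)) = c" by blast
        then show ?thesis using star_star[OF i] by (simp add: add.commute)
      qed (use h i in auto)
    qed
  qed auto
  then show ?thesis by (simp add: cochars_def)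
qed

lemma weyl_bij: "\<sigma> \<in> weyl n \<Longrightarrow> bij \<sigma>"
  by (auto simp: weyl_def permutes_bij)

lemma weyl_in:
  assumes "\<sigma> \<in> weyl n" "i \<in> {1..2*n}" shows "\<sigma> i \<in> {1..2*n}"
proof -
  have "\<sigma> permutes {1..2*n}" using assms(1) by (simp add: weyl_def)
  from permutes_in_image[OF this] assms(2) show ?thesis by blast
qed

lemma weyl_id: "id \<in> weyl n"
  by (simp add: weyl_def permutes_id)

lemma weyl_comp:
  assumes "\<sigma> \<in> weyl n" "\<tau> \<in> weyl n" shows "\<sigma> \<circ> \<tau> \<in> weyl n"
proof -
  have "\<tau> i \<in> {1..2*n}" if "i \<in> {1..2*n}" for i
    by (rule weyl_in[OF assms(2) that])
  then show ?thesis using assms by (auto simp: weyl_def permutes_compose)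
qed

lemma weyl_inv:
  assumes "\<sigma> \<in> weyl n" shows "inv_into UNIV \<sigma> \<in> weyl n"
proof -
  have p: "\<sigma> permutes {1..2*n}" using assms by (simp add: weyl_def)
  have "inv_into UNIV \<sigma> (star n i) = star n (inv_into UNIV \<sigma> i)" if i: "i \<in> {1..2*n}" for i
  proof -
    have "inv_into UNIV \<sigma> i \<in> {1..2*n}"
      using permutes_in_image[OF permutes_inv[OF p]] i by blast
    then have "\<sigma> (star n (inv_into UNIV \<sigma> i)) = star n i"
      using assms permutes_inverses(1)[OF p] by (simp add: weyl_def)
    then show ?thesis using p by (metis permutes_inverses(2))
  qed
  then show ?thesis using p by (simp add: weyl_def permutes_inv)
qed

lemma perm_act_vecs:
  assumes "\<sigma> \<in> weyl n" "x \<in> vecs n" shows "perm_act \<sigma> x \<in> vecs n"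
proof -
  have "inv_into UNIV \<sigma> permutes {1..2*n}" using weyl_inv[OF assms(1)] by (simp add: weyl_def)
  then show ?thesis using assms(2) by (auto simp: vecs_def perm_act_def permutes_not_in)
qed

lemma perm_act_star_sum:
  assumes "\<sigma> \<in> weyl n" and x: "\<forall>i\<in>{1..2*n}. x i + x (star n i) = c" and i: "i \<in> {1..2*n}"
  shows "perm_act \<sigma> x i + perm_act \<sigma> x (star n i) = c"
proof -
  have w: "inv_into UNIV \<sigma> \<in> weyl n" by (rule weyl_inv[OF assms(1)])
  have "inv_into UNIV \<sigma> i \<in> {1..2*n}"
    by (rule weyl_in[OF w i])
  with x have "x (inv_into UNIV \<sigma> i) + x (star n (inv_into UNIV \<sigma> i)) = c" by blast
  moreover have "inv_into UNIV \<sigma> (star n i) = star n (inv_into UNIV \<sigma> i)"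
    using w i by (simp add: weyl_def)
  ultimately show ?thesis by (simp add: perm_act_def)
qed

lemma perm_act_cochars:
  assumes "\<sigma> \<in> weyl n" "(x :: nat \<Rightarrow> 'a::ring_1) \<in> cochars n"
  shows "perm_act \<sigma> x \<in> cochars n"
proof -
  obtain c where "x \<in> vecs n" and c: "\<forall>i\<in>{1..2*n}. x i + x (star n i) = c"
    using assms(2) by (auto simp: cochars_iff)
  then show ?thesis
    using perm_act_vecs[OF assms(1)] perm_act_star_sum[OF assms(1) c] by (auto simp: cochars_iff)
qed

lemma add_cochars:
  assumes "(x :: nat \<Rightarrow> 'a::ring_1) \<in> cochars n" "y \<in> cochars n" shows "x + y \<in> cochars n"
proof -
  obtain c d where "\<forall>i\<in>{1..n}. x i + x (star n i) = c" "\<forall>i\<in>{1..n}. y i + y (star n i) = d"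
    using assms by (auto simp: cochars_def)
  then have "\<forall>i\<in>{1..n}. (x + y) i + (x + y) (star n i) = c + d"
    by (auto simp: add.assoc add.left_commute)
  then show ?thesis using assms by (auto simp: cochars_def vecs_def)
qed

lemma uminus_cochars:
  assumes "(x :: nat \<Rightarrow> 'a::ring_1) \<in> cochars n" shows "- x \<in> cochars n"
proof -
  obtain c where "\<forall>i\<in>{1..n}. x i + x (star n i) = c"
    using assms by (auto simp: cochars_def)
  then have "\<forall>i\<in>{1..n}. (- x) i + (- x) (star n i) = - c"
    by (auto simp: fun_Compl_def)
  then show ?thesis using assms by (auto simp: cochars_def vecs_def)
qed

lemma zero_cochars: "0 \<in> cochars n"
  by (auto simp: cochars_def vecs_def)

lemma group_iw: "group (iw_group n)"
proof (rule groupI)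
  fix x assume "x \<in> carrier (iw_group n)"
  then obtain r \<sigma> where x: "x = (r, \<sigma>)" "r \<in> cochars n" "\<sigma> \<in> weyl n"
    by (auto simp: iw_group_def)
  let ?i = "inv_into UNIV \<sigma>"
  have b: "bij \<sigma>" "bij ?i" "?i \<circ> \<sigma> = id"
    using weyl_bij[OF x(3)] by (simp_all add: bij_imp_bij_inv bij_is_inj)
  have "(- perm_act ?i r, ?i) \<in> carrier (iw_group n)"
    using x by (simp add: iw_group_def weyl_inv perm_act_cochars uminus_cochars)
  moreover have "(- perm_act ?i r, ?i) \<otimes>\<^bsub>iw_group n\<^esub> x = \<one>\<^bsub>iw_group n\<^esub>"
    using b by (simp add: iw_group_def x(1))
  ultimately show "\<exists>y\<in>carrier (iw_group n). y \<otimes>\<^bsub>iw_group n\<^esub> x = \<one>\<^bsub>iw_group n\<^esub>"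
    by blast
qed (auto simp: iw_group_def zero_cochars weyl_id weyl_comp add_cochars perm_act_cochars
    perm_act_simps weyl_bij add.assoc comp_assoc)

definition of_int_vec :: "(nat \<Rightarrow> int) \<Rightarrow> nat \<Rightarrow> 'a::ring_1" where
  "of_int_vec r = (\<lambda>j. of_int (r j))"

(* Used both on integral vectors ('a = int) and on real ones ('a = real). *)
definition iw_act :: "iw \<Rightarrow> (nat \<Rightarrow> 'a::ring_1) \<Rightarrow> nat \<Rightarrow> 'a" where
  "iw_act w x = of_int_vec (fst w) + perm_act (snd w) x"

definition coroot_lattice :: "nat \<Rightarrow> (nat \<Rightarrow> int) set" where
  "coroot_lattice n =
    {r \<in> vecs n. (\<forall>i\<in>{1..2*n}. r i + r (star n i) = 0) \<and> even (\<Sum>i=1..n. r i)}"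

definition affine_weyl :: "nat \<Rightarrow> iw set" where
  "affine_weyl n = coroot_lattice n \<times> weyl0 n"

definition weyl0_orbit :: "nat \<Rightarrow> (nat \<Rightarrow> int) \<Rightarrow> (nat \<Rightarrow> int) set" where
  "weyl0_orbit n \<mu> = (\<lambda>\<sigma>. perm_act \<sigma> \<mu>) ` weyl0 n"

definition base_alcove :: "nat \<Rightarrow> (nat \<Rightarrow> real) set" where
  "base_alcove n =
    {x \<in> cochars n. \<forall>i\<in>{1..2*n}. \<forall>j\<in>{1..2*n}. i < j \<and> j \<noteq> star n i \<longrightarrow>
       -1 < x i - x j \<and> x i - x j < 0}"

definition Perm :: "nat \<Rightarrow> (nat \<Rightarrow> int) \<Rightarrow> iw set" where
  "Perm n \<mu> =
    {w \<in> carrier (iw_group n).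
       affine_weyl n #>\<^bsub>iw_group n\<^esub> w = affine_weyl n #>\<^bsub>iw_group n\<^esub> transl \<mu> \<and>
       (\<forall>x\<in>base_alcove n. iw_act w x - x \<in> convex hull (of_int_vec ` weyl0_orbit n \<mu>))}"

definition omega :: "nat \<Rightarrow> nat \<Rightarrow> int" where
  "omega i = (\<lambda>j. if j \<in> {1..i} then -1 else 0)"

definition mu_vec :: "iw \<Rightarrow> nat \<Rightarrow> nat \<Rightarrow> int" where
  "mu_vec w i = iw_act w (omega i) - omega i"

definition GL_permissible :: "nat \<Rightarrow> iw \<Rightarrow> bool" where
  "GL_permissible n w \<longleftrightarrow>
    (\<forall>i\<in>{0..2*n-1}. \<forall>j\<in>{1..2*n}.
       omega i j \<le> iw_act w (omega i) j \<and> iw_act w (omega i) j \<le> omega i j + 1) \<and>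
    (\<Sum>j=1..2*n. iw_act w (omega 0) j) = int n"

definition totally_isotropic :: "nat \<Rightarrow> (nat \<Rightarrow> int) \<Rightarrow> bool" where
  "totally_isotropic n v \<longleftrightarrow> (\<forall>j\<in>{1..2*n}. v j = 1 - v (star n j))"

definition Perm_sp :: "nat \<Rightarrow> (nat \<Rightarrow> int) \<Rightarrow> iw set" where
  "Perm_sp n \<mu> =
    {w \<in> carrier (iw_group n). GL_permissible n w \<and>
       (\<forall>i\<in>{0..n}. totally_isotropic n (mu_vec w i) \<longrightarrow> mu_vec w i \<in> weyl0_orbit n \<mu>)}"

definition mu1 :: "nat \<Rightarrow> nat \<Rightarrow> int" where
  "mu1 n = (\<lambda>j. if j \<in> {1..n} then 1 else 0)"

definition mu2 :: "nat \<Rightarrow> nat \<Rightarrow> int" where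
  "mu2 n = (\<lambda>j. if j \<in> {1..n-1} \<or> j = n + 1 then 1 else 0)"

end

theory Submission
  imports Defs
begin

text \<open>The \<open>W\<^sup>\<circ>\<close>-orbit of \<open>\<mu>\<close> consists of the 0/1-vectors with \<open>v\<^sub>j + v\<^sub>j\<^sub>* = 1\<close> whose first half has a fixed parity,
  and \<open>\<sigma> \<in> W\<close> is even iff it moves an even number of indices from the first half to the second.
  Hence the congruence modulo \<open>W\<^sub>a\<close> is the spin condition at \<open>i = 0\<close> and \<open>i = n\<close>.
  The displacement \<open>w x - x\<close> at the point \<open>(\<omega>\<^sub>i + \<omega>\<^sub>2\<^sub>n\<^sub>-\<^sub>i) / 2\<close> is \<open>\<mu>\<^sub>i\<close> if \<open>\<mu>\<^sub>i\<close> is totally isotropic;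
  otherwise it has a positive even number of half-integral coordinates in the first half, so it is
  the midpoint of two 0/1-vectors of either parity. The remaining vertices of the alcove are integral
  and are handled by a parity argument, and \<open>w x - x\<close> is affine in \<open>x\<close>. Conversely, a vertex of the
  wrong parity has \<open>\<ell>\<^sup>1\<close>-distance at least 1 (in the first half) from the convex hull of the orbit.\<close>

section \<open>Signs and half sums in the Weyl group\<close>

lemma sum_fun_apply: "(\<Sum>i\<in>A. f i) x = (\<Sum>i\<in>A. f i x)"
  for f :: "'a \<Rightarrow> 'b \<Rightarrow> 'c::comm_monoid_add"
  by (induction A rule: infinite_finite_induct) simp_all

lemma weyl_star:
  assumes "\<sigma> \<in> weyl n" "i \<in> {1..2*n}"
  shows "\<sigma> (star n i) = star n (\<sigma> i)"
  using assms by (simp add: weyl_def)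

lemma weyl_permutes: "\<sigma> \<in> weyl n \<Longrightarrow> \<sigma> permutes {1..2*n}"
  by (simp add: weyl_def)

lemma weyl_permutation: "\<sigma> \<in> weyl n \<Longrightarrow> permutation \<sigma>"
  using weyl_permutes permutes_imp_permutation by blast

lemma inj_weyl: "\<sigma> \<in> weyl n \<Longrightarrow> inj \<sigma>"
  using weyl_bij bij_is_inj by blast

lemma weyl_range:
  assumes "\<sigma> \<in> weyl n" "1 \<le> i" "i \<le> 2*n"
  shows "1 \<le> \<sigma> i" "\<sigma> i \<le> 2*n"
  using weyl_in[OF assms(1), of i] assms by auto

lemma sum_star_pairs:
  fixes f :: "nat \<Rightarrow> 'a::comm_monoid_add"
  shows "(\<Sum>j=1..2*n. f j) = (\<Sum>j=1..n. f j + f (star n j))"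
proof -
  have "{1..2*n} = {1..n} \<union> {n+1..2*n}" by auto
  then have "(\<Sum>j=1..2*n. f j) = (\<Sum>j=1..n. f j) + (\<Sum>j=n+1..2*n. f j)"
    by (simp add: sum.union_disjoint)
  also have "(\<Sum>j=n+1..2*n. f j) = (\<Sum>j=1..n. f (star n j))"
    by (rule sum.reindex_bij_witness[of _ "star n" "star n"]) (auto simp: star_def)
  finally show ?thesis by (simp add: sum.distrib)
qed

text \<open>With \<open>weyl n\<close> read as the signed permutations of n letters, this counts
  sign changes; its parity turns out to be the sign of \<open>\<sigma>\<close>, so
  \<open>weyl0 n\<close> is the Weyl group of type D_n.\<close>

definition crossings :: "nat \<Rightarrow> (nat \<Rightarrow> nat) \<Rightarrow> nat" where
  "crossings n \<sigma> = card {j \<in> {1..n}. \<sigma> j > n}"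

definition fold_star :: "nat \<Rightarrow> nat \<Rightarrow> nat" where
  "fold_star n j = (if j \<le> n then j else star n j)"

text \<open>\<open>\<sigma>\<close> commutes with \<open>star n\<close>, hence permutes the star
  pairs, and each pair has exactly one member in the first half.\<close>

lemma bij_betw_fold_star:
  assumes "\<sigma> \<in> weyl n"
  shows "bij_betw (\<lambda>j. fold_star n (\<sigma> j)) {1..n} {1..n}"
proof -
  have mem: "fold_star n (\<sigma> j) \<in> {1..n}" if "j \<in> {1..n}" for j
    using weyl_range[OF assms, of j] that by (auto simp: fold_star_def star_def)
  have "inj_on (\<lambda>j. fold_star n (\<sigma> j)) {1..n}"
  proof (rule inj_onI)
    fix i j assume i: "i \<in> {1..n}" and j: "j \<in> {1..n}"
      and eq: "fold_star n (\<sigma> i) = fold_star n (\<sigma> j)"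
    have "\<sigma> i = \<sigma> j \<or> \<sigma> i = star n (\<sigma> j)"
      using eq weyl_range[OF assms, of i] weyl_range[OF assms, of j] i j
      by (auto simp: fold_star_def star_def split: if_splits)
    then have "\<sigma> i = \<sigma> j \<or> \<sigma> i = \<sigma> (star n j)"
      using weyl_star[OF assms, of j] j by simp
    then have "i = j \<or> i = star n j" by (simp only: inj_eq[OF inj_weyl[OF assms]])
    then show "i = j" using i j by (auto simp: star_def)
  qed
  moreover have "(\<lambda>j. fold_star n (\<sigma> j)) ` {1..n} \<subseteq> {1..n}" using mem by blast
  ultimately show ?thesis
    by (simp add: bij_betw_def endo_inj_surj)
qed

text \<open>Folding only rearranges the half sum, so the discrepancy comes from crossings: each
  replaces an entry x by c - x, which is congruent to x + c modulo 2.\<close>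

lemma half_sum_weyl_cong:
  fixes v :: "nat \<Rightarrow> int"
  assumes "\<sigma> \<in> weyl n" and v: "\<And>i. i \<in> {1..2*n} \<Longrightarrow> v i + v (star n i) = c"
  shows "even ((\<Sum>j=1..n. v (\<sigma> j)) - (\<Sum>j=1..n. v j) - c * int (crossings n \<sigma>))"
proof -
  have "(\<Sum>j=1..n. v j) = (\<Sum>j=1..n. v (fold_star n (\<sigma> j)))"
    using sum.reindex_bij_betw[OF bij_betw_fold_star[OF assms(1)], of v] by simp
  moreover have "c * int (crossings n \<sigma>) = (\<Sum>j=1..n. if \<sigma> j > n then c else 0)"
    by (simp add: crossings_def sum.If_cases Int_def)
  ultimately have "(\<Sum>j=1..n. v (\<sigma> j)) - (\<Sum>j=1..n. v j) - c * int (crossings n \<sigma>)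
      = (\<Sum>j=1..n. v (\<sigma> j) - v (fold_star n (\<sigma> j)) - (if \<sigma> j > n then c else 0))"
    by (simp add: sum_subtractf)
  moreover have "even (v (\<sigma> j) - v (fold_star n (\<sigma> j)) - (if \<sigma> j > n then c else 0))"
    if "j \<in> {1..n}" for j
  proof (cases "\<sigma> j > n")
    case True
    have "\<sigma> j \<in> {1..2*n}" using weyl_in[OF assms(1), of j] that by auto
    from v[OF this] have "v (\<sigma> j) - v (star n (\<sigma> j)) - c = 2 * (- v (star n (\<sigma> j)))" by simp
    then have "even (v (\<sigma> j) - v (star n (\<sigma> j)) - c)" by (metis dvd_triv_left)
    then show ?thesis using True by (simp add: fold_star_def)
  qed (simp add: fold_star_def)
  ultimately show ?thesis by (simp only: dvd_sum)
qed

text \<open>If \<open>\<sigma>\<close> sends k > n to j \<le> n, then it sends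
  \<open>star n k\<close> \<le> n to \<open>star n j\<close> > n; this matches the crossings of the
  inverse with those of \<open>\<sigma>\<close>.\<close>

lemma crossings_inv:
  assumes "\<sigma> \<in> weyl n"
  shows "crossings n (inv_into UNIV \<sigma>) = crossings n \<sigma>"
proof -
  have p: "\<sigma> permutes {1..2*n}" by (rule weyl_permutes[OF assms])
  have star_inv: "inv_into UNIV \<sigma> (star n j) = star n (inv_into UNIV \<sigma> j)" if "j \<in> {1..2*n}" for j
    by (rule weyl_star[OF weyl_inv[OF assms] that])
  show ?thesis unfolding crossings_def
  proof (rule bij_betw_same_card[of "\<lambda>j. star n (inv_into UNIV \<sigma> j)"],
      rule bij_betw_byWitness[of _ "\<lambda>j. star n (\<sigma> j)"])
    show "\<forall>j\<in>{j \<in> {1..n}. n < inv_into UNIV \<sigma> j}. star n (\<sigma> (star n (inv_into UNIV \<sigma> j))) = j"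
      using weyl_range[OF weyl_inv[OF assms]] weyl_star[OF assms] permutes_inverses[OF p]
      by (auto simp: star_star)
    show "\<forall>j\<in>{j \<in> {1..n}. n < \<sigma> j}. star n (inv_into UNIV \<sigma> (star n (\<sigma> j))) = j"
      using weyl_range[OF assms] star_inv permutes_inverses[OF p]
      by (auto simp: star_star)
    show "(\<lambda>j. star n (inv_into UNIV \<sigma> j)) ` {j \<in> {1..n}. n < inv_into UNIV \<sigma> j} \<subseteq> {j \<in> {1..n}. n < \<sigma> j}"
    proof (rule image_subsetI)
      fix j assume j: "j \<in> {j \<in> {1..n}. n < inv_into UNIV \<sigma> j}"
      then have "1 \<le> inv_into UNIV \<sigma> j" "inv_into UNIV \<sigma> j \<le> 2*n" using weyl_range[OF weyl_inv[OF assms], of j] by auto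
      then have "\<sigma> (star n (inv_into UNIV \<sigma> j)) = star n j"
        using weyl_star[OF assms, of "inv_into UNIV \<sigma> j"] permutes_inverses[OF p] by auto
      then show "star n (inv_into UNIV \<sigma> j) \<in> {j \<in> {1..n}. n < \<sigma> j}"
        using j \<open>inv_into UNIV \<sigma> j \<le> 2*n\<close> by (auto simp: star_def)
    qed
    show "(\<lambda>j. star n (\<sigma> j)) ` {j \<in> {1..n}. n < \<sigma> j} \<subseteq> {j \<in> {1..n}. n < inv_into UNIV \<sigma> j}"
    proof (rule image_subsetI)
      fix j assume j: "j \<in> {j \<in> {1..n}. n < \<sigma> j}"
      then have "1 \<le> \<sigma> j" "\<sigma> j \<le> 2*n" using weyl_range[OF assms, of j] by auto
      then have "inv_into UNIV \<sigma> (star n (\<sigma> j)) = star n j"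
        using star_inv[of "\<sigma> j"] permutes_inverses[OF p] by auto
      then show "star n (\<sigma> j) \<in> {j \<in> {1..n}. n < inv_into UNIV \<sigma> j}"
        using j \<open>\<sigma> j \<le> 2*n\<close> by (auto simp: star_def)
    qed
  qed
qed

text \<open>Such \<open>\<sigma>\<close> preserves both halves and acts on the second as the star
  conjugate of its action p on the first, so every sign occurs squared.\<close>

lemma sign_weyl_no_crossings:
  assumes w: "\<sigma> \<in> weyl n" and nc: "crossings n \<sigma> = 0"
  shows "sign \<sigma> = 1"
proof -
  define s where "s = (\<lambda>j. if j \<in> {1..2*n} then star n j else j)"
  define p where "p = (\<lambda>j. if j \<in> {1..n} then \<sigma> j else j)"
  have s_s: "s (s j) = j" for j using star_in[of j n] by (auto simp: s_def star_star)
  have s: "s permutes {1..2*n}"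
    by (rule bij_imp_permutes) (auto simp: s_def star_def intro!: bij_betw_byWitness[of _ "star n"])
  have low: "\<sigma> j \<in> {1..n}" if "j \<in> {1..n}" for j
  proof -
    have "{j \<in> {1..n}. \<sigma> j > n} = {}" using nc by (simp add: crossings_def)
    then have "\<not> \<sigma> j > n" using that by blast
    then show ?thesis using weyl_range[OF w, of j] that by auto
  qed
  have "p permutes {1..n}"
  proof (rule bij_imp_permutes)
    have "inj_on p {1..n}" using inj_weyl[OF w] by (auto simp: p_def inj_on_def)
    moreover have "p ` {1..n} \<subseteq> {1..n}" using low by (auto simp: p_def)
    ultimately show "bij_betw p {1..n} {1..n}" by (simp add: bij_betw_def endo_inj_surj)
  qed (auto simp: p_def)
  then have p: "permutation p" using permutes_imp_permutation by blast
  have ps: "permutation s" using s permutes_imp_permutation by blast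
  have "\<sigma> j = (p \<circ> (s \<circ> p \<circ> s)) j" for j
  proof -
    consider "j \<in> {1..n}" | "j \<in> {n+1..2*n}" | "j \<notin> {1..2*n}" by fastforce
    then show ?thesis
    proof cases
      case 1 then show ?thesis by (auto simp: p_def s_def star_def)
    next
      case 2
      then have j: "star n j \<in> {1..n}" "j \<in> {1..2*n}" by (auto simp: star_def)
      have "star n (\<sigma> (star n j)) = \<sigma> j"
        using weyl_star[OF w, of j] j weyl_range[OF w, of j] by (simp add: star_star)
      moreover have "\<sigma> (star n j) \<in> {1..n}" by (rule low[OF j(1)])
      ultimately have "(s \<circ> p \<circ> s) j = \<sigma> j" "p (\<sigma> j) = \<sigma> j"
        using j by (auto simp: p_def s_def star_def)
      then show ?thesis by simp
    next
      case 3 then show ?thesis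
        using permutes_not_in[OF weyl_permutes[OF w], of j] by (auto simp: p_def s_def)
    qed
  qed
  then have "\<sigma> = p \<circ> (s \<circ> p \<circ> s)" by blast
  then have "sign \<sigma> = sign p * (sign s * sign p * sign s)"
    using p ps by (simp add: sign_compose permutation_compose)
  also have "\<dots> = (sign p * sign p) * (sign s * sign s)" by (simp only: ac_simps)
  finally show ?thesis by simp
qed

text \<open>Induction removing one crossing at a time: exchanging a crossing value
  \<open>\<sigma> j\<close> with its star partner is a transposition lying in
  \<open>weyl n\<close>.\<close>

lemma sign_weyl: "\<sigma> \<in> weyl n \<Longrightarrow> sign \<sigma> = (-1) ^ crossings n \<sigma>"
proof (induction "crossings n \<sigma>" arbitrary: \<sigma>)
  case 0
  then show ?case using sign_weyl_no_crossings[of \<sigma> n] by simp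
next
  case (Suc m)
  note w = Suc.prems
  let ?N = "\<lambda>\<sigma>. {j \<in> {1..n}. \<sigma> j > n}"
  have "?N \<sigma> \<noteq> {}" using Suc.hyps(2) by (auto simp: crossings_def simp del: Collect_empty_eq)
  then obtain j where j: "j \<in> {1..n}" "\<sigma> j > n" by blast
  define a where "a = \<sigma> j"
  define b where "b = star n a"
  have a: "a \<in> {1..2*n}" "a > n" using weyl_in[OF w, of j] j by (auto simp: a_def)
  have b: "b \<in> {1..n}" "star n b = a" using a by (auto simp: b_def star_def)
  define \<tau> where "\<tau> = Transposition.transpose a b \<circ> \<sigma>"
  have ab: "a \<noteq> b" using a b by auto
  have "Transposition.transpose a b \<in> weyl n"
  proof -
    have "Transposition.transpose a b (star n i) = star n (Transposition.transpose a b i)" if "i \<in> {1..2*n}" for i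
      using that a b ab by (auto simp: Transposition.transpose_def star_def b_def)
    then show ?thesis using a b by (auto simp: weyl_def intro!: permutes_swap_id)
  qed
  then have \<tau>: "\<tau> \<in> weyl n" unfolding \<tau>_def using w by (rule weyl_comp)
  \<comment> \<open>The value b is attained at \<open>star n j\<close>, outside the first half, so
    the transposition alters the first half only at j.\<close>
  have sj: "\<sigma> i = b \<longleftrightarrow> i = star n j" for i
  proof -
    have "\<sigma> (star n j) = b" using weyl_star[OF w, of j] j by (simp add: a_def b_def)
    then show ?thesis using inj_weyl[OF w] by (auto dest: injD)
  qed
  have "?N \<tau> = ?N \<sigma> - {j}"
  proof (rule Set.set_eqI)
    fix i
    show "i \<in> ?N \<tau> \<longleftrightarrow> i \<in> ?N \<sigma> - {j}"
    proof (cases "i \<in> {1..n}")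
      case True
      then have "\<sigma> i \<noteq> b" using sj[of i] j by (auto simp: star_def)
      moreover have "\<sigma> i = a \<longleftrightarrow> i = j" using inj_weyl[OF w] by (auto simp: a_def dest: injD)
      ultimately show ?thesis using True a b by (auto simp: \<tau>_def Transposition.transpose_def)
    qed auto
  qed
  moreover have "Suc (card (?N \<sigma> - {j})) = card (?N \<sigma>)"
    using j by (intro card_Suc_Diff1) auto
  ultimately have "crossings n \<sigma> = Suc (crossings n \<tau>)"
    unfolding crossings_def by presburger
  with Suc.hyps have m: "m = crossings n \<tau>" by simp
  have "sign \<tau> = - sign \<sigma>"
    using ab weyl_permutation[OF w] by (simp add: \<tau>_def sign_compose permutation_swap_id sign_swap_id)
  with Suc.hyps(1)[OF m \<tau>] \<open>crossings n \<sigma> = Suc (crossings n \<tau>)\<close> show ?case by simp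
qed

lemma evenperm_weyl_iff:
  assumes "\<sigma> \<in> weyl n"
  shows "evenperm \<sigma> \<longleftrightarrow> even (crossings n \<sigma>)"
  using sign_weyl[OF assms] by (auto simp: sign_def minus_one_power_iff split: if_splits)

lemma weyl0_inv: "\<sigma> \<in> weyl0 n \<Longrightarrow> inv_into UNIV \<sigma> \<in> weyl0 n"
  using evenperm_inv[OF weyl_permutation] by (auto simp: weyl0_def weyl_inv)

lemma weyl0_comp: "\<sigma> \<in> weyl0 n \<Longrightarrow> \<tau> \<in> weyl0 n \<Longrightarrow> \<sigma> \<circ> \<tau> \<in> weyl0 n"
  using evenperm_comp[OF weyl_permutation weyl_permutation] by (auto simp: weyl0_def weyl_comp)

lemma weyl0_id: "id \<in> weyl0 n"
  by (simp add: weyl0_def weyl_id)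

text \<open>\<open>perm_act\<close> composes with the inverse, which has as many crossings as
  \<open>\<sigma>\<close>. The case c = 1 with even \<open>\<sigma>\<close> serves orbit vectors,
  the case c = 0 with arbitrary \<open>\<sigma>\<close> serves coroots.\<close>

lemma half_sum_perm_act:
  fixes v :: "nat \<Rightarrow> int"
  assumes "\<sigma> \<in> weyl n" and "\<And>i. i \<in> {1..2*n} \<Longrightarrow> v i + v (star n i) = c"
    and "evenperm \<sigma> \<or> even c"
  shows "even (\<Sum>j=1..n. perm_act \<sigma> v j) \<longleftrightarrow> even (\<Sum>j=1..n. v j)"
proof -
  have "even (c * int (crossings n (inv_into UNIV \<sigma>)))"
    using assms by (auto simp: crossings_inv evenperm_weyl_iff)
  then show ?thesis
    using half_sum_weyl_cong[OF weyl_inv[OF assms(1)], of v c] assms(2) by (simp add: perm_act_def)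
qed

section \<open>The orbits of 0/1 vectors under the even Weyl group\<close>

text \<open>Vertices of the unit cube in the first n coordinates, the others being forced; for n
  \<ge> 1 they form two \<open>weyl0 n\<close>-orbits, those of \<open>mu1 n\<close> and
  \<open>mu2 n\<close>.\<close>

definition binary_spinor :: "nat \<Rightarrow> (nat \<Rightarrow> int) \<Rightarrow> bool" where
  "binary_spinor n v \<longleftrightarrow>
    v \<in> vecs n \<and> (\<forall>j\<in>{1..2*n}. v j \<in> {0, 1} \<and> v j + v (star n j) = 1)"

lemma binary_spinor_cochars: "binary_spinor n v \<Longrightarrow> v \<in> cochars n"
  by (auto simp: binary_spinor_def cochars_iff)

text \<open>For the converse, the involution swapping the star pairs on which v and
  \<open>\<mu>\<close> differ carries \<open>\<mu>\<close> to v; its crossings are the differing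
  first-half positions, even in number when the half sums agree modulo 2.\<close>

lemma weyl0_orbit_iff:
  assumes \<mu>: "binary_spinor n \<mu>"
  shows "v \<in> weyl0_orbit n \<mu> \<longleftrightarrow>
    binary_spinor n v \<and> (even (\<Sum>j=1..n. v j) \<longleftrightarrow> even (\<Sum>j=1..n. \<mu> j))"
proof
  assume "v \<in> weyl0_orbit n \<mu>"
  then obtain \<sigma> where \<sigma>: "\<sigma> \<in> weyl n" "evenperm \<sigma>" and v: "v = perm_act \<sigma> \<mu>"
    by (auto simp: weyl0_orbit_def weyl0_def)
  have "v \<in> vecs n" using perm_act_vecs[OF \<sigma>(1), of \<mu>] \<mu> by (simp add: v binary_spinor_def)
  moreover have "v j \<in> {0, 1}" if "j \<in> {1..2*n}" for j
    using weyl_in[OF weyl_inv[OF \<sigma>(1)] that] \<mu>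
    by (simp add: v perm_act_def binary_spinor_def)
  moreover have "v j + v (star n j) = 1" if "j \<in> {1..2*n}" for j
    unfolding v using \<mu> by (intro perm_act_star_sum[OF \<sigma>(1)] that) (simp add: binary_spinor_def)
  ultimately have "binary_spinor n v" by (simp add: binary_spinor_def)
  moreover have "even (\<Sum>j=1..n. v j) \<longleftrightarrow> even (\<Sum>j=1..n. \<mu> j)"
    unfolding v using \<mu> \<sigma> by (intro half_sum_perm_act) (auto simp: binary_spinor_def)
  ultimately show "binary_spinor n v \<and> (even (\<Sum>j=1..n. v j) \<longleftrightarrow> even (\<Sum>j=1..n. \<mu> j))" by blast
next
  assume asm: "binary_spinor n v \<and> (even (\<Sum>j=1..n. v j) \<longleftrightarrow> even (\<Sum>j=1..n. \<mu> j))"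
  define \<sigma> where "\<sigma> = (\<lambda>j. if j \<in> {1..2*n} \<and> v j \<noteq> \<mu> j then star n j else j)"
  have star_eq: "v (star n j) = \<mu> (star n j) \<longleftrightarrow> v j = \<mu> j" if "j \<in> {1..2*n}" for j
    using asm \<mu> that unfolding binary_spinor_def by (metis add_left_cancel add_right_cancel)
  have inv: "\<sigma> (\<sigma> j) = j" for j
    using star_eq[of j] star_in[of j n] by (auto simp: \<sigma>_def star_star)
  then have inv_eq: "inv_into UNIV \<sigma> = \<sigma>" by (intro inv_equality) auto
  have mem: "\<sigma> j \<in> {1..2*n}" if "j \<in> {1..2*n}" for j using star_in[OF that] that by (auto simp: \<sigma>_def)
  have "\<sigma> permutes {1..2*n}"
  proof (rule bij_imp_permutes)
    show "bij_betw \<sigma> {1..2*n} {1..2*n}"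
      by (rule bij_betw_byWitness[of _ \<sigma>]) (use inv mem in blast)+
  qed (auto simp: \<sigma>_def)
  moreover have "\<sigma> (star n i) = star n (\<sigma> i)" if "i \<in> {1..2*n}" for i
    using star_eq[OF that] star_in[OF that] that by (auto simp: \<sigma>_def star_star)
  ultimately have w: "\<sigma> \<in> weyl n" by (simp add: weyl_def)
  have crossing: "{j \<in> {1..n}. \<sigma> j > n} = {j \<in> {1..n}. v j \<noteq> \<mu> j}"
    by (auto simp: \<sigma>_def star_def split: if_splits)
  have "int (crossings n \<sigma>) = (\<Sum>j=1..n. if v j \<noteq> \<mu> j then 1 else 0)"
    unfolding crossings_def crossing by (simp add: sum.If_cases Int_def)
  then have "(\<Sum>j=1..n. v j) - (\<Sum>j=1..n. \<mu> j) - int (crossings n \<sigma>)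
      = (\<Sum>j=1..n. v j - \<mu> j - (if v j \<noteq> \<mu> j then 1 else 0))"
    by (simp add: sum_subtractf)
  moreover have "even (v j - \<mu> j - (if v j \<noteq> \<mu> j then 1 else 0))" if "j \<in> {1..n}" for j
  proof -
    have "v j \<in> {0,1}" "\<mu> j \<in> {0,1}" using asm \<mu> that by (auto simp: binary_spinor_def)
    then show ?thesis by auto
  qed
  ultimately have "even ((\<Sum>j=1..n. v j) - (\<Sum>j=1..n. \<mu> j) - int (crossings n \<sigma>))"
    by (simp only: dvd_sum)
  then have "evenperm \<sigma>" using asm evenperm_weyl_iff[OF w] by auto
  moreover have "perm_act \<sigma> \<mu> = v"
  proof
    fix j
    have act: "perm_act \<sigma> \<mu> j = \<mu> (\<sigma> j)" by (simp only: perm_act_def inv_eq)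
    show "perm_act \<sigma> \<mu> j = v j"
    proof (cases "j \<in> {1..2*n}")
      case True
      have "v j \<in> {0,1}" "\<mu> j \<in> {0,1}" "\<mu> j + \<mu> (star n j) = 1"
        using asm \<mu> True by (simp_all add: binary_spinor_def)
      then show ?thesis unfolding act unfolding \<sigma>_def using True by auto
    next
      case False
      then show ?thesis unfolding act using asm \<mu> by (auto simp: \<sigma>_def binary_spinor_def vecs_def)
    qed
  qed
  ultimately show "v \<in> weyl0_orbit n \<mu>" using w by (force simp: weyl0_orbit_def weyl0_def)
qed

section \<open>The congruence modulo the affine Weyl group\<close>

lemma perm_act_coroot_lattice:
  assumes "\<sigma> \<in> weyl n" "q \<in> coroot_lattice n"
  shows "perm_act \<sigma> q \<in> coroot_lattice n"
proof -
  have q: "q \<in> vecs n" "\<forall>i\<in>{1..2*n}. q i + q (star n i) = 0" "even (\<Sum>i=1..n. q i)"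
    using assms(2) by (auto simp: coroot_lattice_def)
  have "even (\<Sum>i=1..n. perm_act \<sigma> q i)"
    using half_sum_perm_act[OF assms(1), of q 0] q by auto
  then show ?thesis
    using perm_act_vecs[OF assms(1) q(1)] perm_act_star_sum[OF assms(1) q(2)]
    by (simp add: coroot_lattice_def)
qed

lemma coroot_lattice_cochars: "q \<in> coroot_lattice n \<Longrightarrow> q \<in> cochars n"
  by (auto simp: coroot_lattice_def cochars_iff)

lemma subgroup_affine_weyl: "subgroup (affine_weyl n) (iw_group n)"
proof (rule group.subgroupI[OF group_iw])
  show "affine_weyl n \<subseteq> carrier (iw_group n)"
    by (auto simp: affine_weyl_def iw_group_def coroot_lattice_cochars weyl0_def)
  have zero: "0 \<in> coroot_lattice n" by (simp add: coroot_lattice_def vecs_def)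
  then show "affine_weyl n \<noteq> {}" using weyl0_id by (auto simp: affine_weyl_def)
  have add: "q + q' \<in> coroot_lattice n" if "q \<in> coroot_lattice n" "q' \<in> coroot_lattice n" for q q'
  proof -
    have "(q + q') i + (q + q') (star n i) = 0" if "i \<in> {1..2*n}" for i
    proof -
      have "q i + q (star n i) = 0" "q' i + q' (star n i) = 0"
        using \<open>q \<in> _\<close> \<open>q' \<in> _\<close> that by (simp_all add: coroot_lattice_def)
      then show ?thesis by simp
    qed
    then show ?thesis using that by (simp add: coroot_lattice_def vecs_def sum.distrib)
  qed
  have neg: "- q \<in> coroot_lattice n" if "q \<in> coroot_lattice n" for q
  proof -
    have q: "q \<in> vecs n" "\<forall>i\<in>{1..2*n}. q i + q (star n i) = 0" "even (\<Sum>i=1..n. q i)"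
      using that by (auto simp: coroot_lattice_def)
    have "\<forall>i\<in>{1..2*n}. (- q) i + (- q) (star n i) = 0"
      unfolding fun_Compl_def using q(2) by (metis minus_add_distrib minus_zero add.commute)
    moreover have "even (\<Sum>i=1..n. (- q) i)"
      unfolding fun_Compl_def sum_negf using q(3) by simp
    moreover have "- q \<in> vecs n" using q(1) by (simp add: vecs_def fun_Compl_def)
    ultimately show ?thesis by (simp add: coroot_lattice_def)
  qed
  fix a assume a: "a \<in> affine_weyl n"
  obtain q \<sigma> where q: "a = (q, \<sigma>)" "q \<in> coroot_lattice n" "\<sigma> \<in> weyl0 n"
    using a by (auto simp: affine_weyl_def)
  let ?b = "(- perm_act (inv_into UNIV \<sigma>) q, inv_into UNIV \<sigma>)"
  have w: "\<sigma> \<in> weyl n" "inv_into UNIV \<sigma> \<in> weyl n" using q weyl_inv by (auto simp: weyl0_def)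
  have "?b \<in> affine_weyl n"
    using q w by (simp add: affine_weyl_def weyl0_inv neg perm_act_coroot_lattice)
  moreover have "?b \<otimes>\<^bsub>iw_group n\<^esub> a = \<one>\<^bsub>iw_group n\<^esub>"
    using weyl_bij[OF w(1)] by (simp add: iw_group_def q(1) bij_is_inj)
  moreover have "a \<in> carrier (iw_group n)" "?b \<in> carrier (iw_group n)"
    using a \<open>?b \<in> affine_weyl n\<close> \<open>affine_weyl n \<subseteq> carrier (iw_group n)\<close> by auto
  ultimately show "inv\<^bsub>iw_group n\<^esub> a \<in> affine_weyl n"
    using group.inv_equality[OF group_iw, of n ?b a] by simp
  fix b assume b: "b \<in> affine_weyl n"
  obtain q' \<sigma>' where "b = (q', \<sigma>')" "q' \<in> coroot_lattice n" "\<sigma>' \<in> weyl0 n"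
    using b by (auto simp: affine_weyl_def)
  then show "a \<otimes>\<^bsub>iw_group n\<^esub> b \<in> affine_weyl n"
    using q w by (simp add: affine_weyl_def iw_group_def add perm_act_coroot_lattice weyl0_comp)
qed

text \<open>Equality of cosets means that \<open>\<sigma>\<close> is even and
  \<open>r - perm_act \<sigma> \<mu>\<close> lies in the coroot lattice. As
  \<open>perm_act \<sigma> \<mu>\<close> has pair sums 1 and the parity of \<open>\<mu>\<close>, the
  latter becomes a condition on r alone.\<close>

lemma coset_eq_transl_iff:
  assumes \<mu>: "binary_spinor n \<mu>" and w: "(r, \<sigma>) \<in> carrier (iw_group n)"
  shows "affine_weyl n #>\<^bsub>iw_group n\<^esub> (r, \<sigma>) = affine_weyl n #>\<^bsub>iw_group n\<^esub> transl \<mu> \<longleftrightarrow>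
    \<sigma> \<in> weyl0 n \<and> (\<forall>j\<in>{1..2*n}. r j + r (star n j) = 1) \<and>
    (even (\<Sum>j=1..n. r j) \<longleftrightarrow> even (\<Sum>j=1..n. \<mu> j))" (is "?L = ?R \<longleftrightarrow> ?cond")
proof -
  interpret G: group "iw_group n" by (rule group_iw)
  have t: "transl \<mu> \<in> carrier (iw_group n)"
    using \<mu> by (simp add: transl_def iw_group_def binary_spinor_cochars weyl_id)
  have sg: "subgroup (affine_weyl n) (iw_group n)" by (rule subgroup_affine_weyl)
  have rs: "r \<in> cochars n" "\<sigma> \<in> weyl n" using w by (auto simp: iw_group_def)
  have "?L = ?R \<longleftrightarrow> (r, \<sigma>) \<in> ?R"
    using G.repr_independence[OF _ t sg] G.rcos_self[OF w sg] by blast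
  also have "\<dots> \<longleftrightarrow> \<sigma> \<in> weyl0 n \<and> r - perm_act \<sigma> \<mu> \<in> coroot_lattice n"
  proof
    assume "(r, \<sigma>) \<in> ?R"
    then show "\<sigma> \<in> weyl0 n \<and> r - perm_act \<sigma> \<mu> \<in> coroot_lattice n"
      by (auto simp: r_coset_def transl_def iw_group_def affine_weyl_def)
  next
    assume "\<sigma> \<in> weyl0 n \<and> r - perm_act \<sigma> \<mu> \<in> coroot_lattice n"
    then have "(r - perm_act \<sigma> \<mu>, \<sigma>) \<in> affine_weyl n" by (simp add: affine_weyl_def)
    moreover have "(r, \<sigma>) = (r - perm_act \<sigma> \<mu>, \<sigma>) \<otimes>\<^bsub>iw_group n\<^esub> transl \<mu>"
      by (simp add: iw_group_def transl_def)
    ultimately show "(r, \<sigma>) \<in> ?R" unfolding r_coset_def by blast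
  qed
  also have "\<dots> \<longleftrightarrow> ?cond"
  proof (cases "\<sigma> \<in> weyl0 n")
    case True
    have "r \<in> vecs n" "perm_act \<sigma> \<mu> \<in> vecs n"
      using rs \<mu> perm_act_vecs[of \<sigma> n \<mu>] by (auto simp: cochars_def binary_spinor_def)
    then have "r - perm_act \<sigma> \<mu> \<in> vecs n" by (auto simp: vecs_def)
    moreover have "perm_act \<sigma> \<mu> j + perm_act \<sigma> \<mu> (star n j) = 1" if "j \<in> {1..2*n}" for j
      using \<mu> by (intro perm_act_star_sum[OF rs(2)] that) (simp add: binary_spinor_def)
    then have "(r - perm_act \<sigma> \<mu>) j + (r - perm_act \<sigma> \<mu>) (star n j) = 0 \<longleftrightarrow> r j + r (star n j) = 1"
      if "j \<in> {1..2*n}" for j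
      using that by (smt (verit) minus_apply)
    moreover have "even (\<Sum>j=1..n. perm_act \<sigma> \<mu> j) \<longleftrightarrow> even (\<Sum>j=1..n. \<mu> j)"
      using \<mu> True by (intro half_sum_perm_act) (auto simp: binary_spinor_def weyl0_def)
    ultimately show ?thesis using True by (simp add: coroot_lattice_def sum_subtractf)
  qed simp
  finally show ?thesis .
qed

section \<open>The vectors \<open>mu_vec\<close> of a GL-permissible element\<close>

lemma mu_vec_apply: "mu_vec (r, \<sigma>) i j = r j + omega i (inv_into UNIV \<sigma> j) - omega i j"
  by (simp add: mu_vec_def iw_act_def of_int_vec_def perm_act_def)

lemma omega_0: "omega 0 j = 0"
  by (simp add: omega_def)

lemma displacement_apply:
  fixes x :: "nat \<Rightarrow> real"
  shows "(iw_act (r, \<sigma>) x - x) j = of_int (r j) + x (inv_into UNIV \<sigma> j) - x j"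
  by (simp add: iw_act_def of_int_vec_def perm_act_def)

text \<open>Coordinatewise form of GL-permissibility, see \<open>GL_permissible_iff\<close>. One
  inclusion obtains it from the vectors \<open>omega i\<close>, the other from the displacement of a
  single interior alcove point.\<close>

locale gl_permissible_iw =
  fixes n :: nat and r :: "nat \<Rightarrow> int" and \<sigma> :: "nat \<Rightarrow> nat"
  assumes weyl: "\<sigma> \<in> weyl n"
    and spinor: "binary_spinor n r"
    and descent: "j \<in> {1..2*n} \<Longrightarrow> inv_into UNIV \<sigma> j < j \<Longrightarrow> r j = 1"
    and ascent: "j \<in> {1..2*n} \<Longrightarrow> inv_into UNIV \<sigma> j > j \<Longrightarrow> r j = 0"
begin

abbreviation \<tau> :: "nat \<Rightarrow> nat" where "\<tau> \<equiv> inv_into UNIV \<sigma>"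

lemma tau_weyl: "\<tau> \<in> weyl n"
  by (rule weyl_inv[OF weyl])

lemma tau_in: "j \<in> {1..2*n} \<Longrightarrow> \<tau> j \<in> {1..2*n}"
  by (rule weyl_in[OF tau_weyl])

lemma tau_star: "j \<in> {1..2*n} \<Longrightarrow> \<tau> (star n j) = star n (\<tau> j)"
  by (rule weyl_star[OF tau_weyl])

lemma tau_outside: "j \<notin> {1..2*n} \<Longrightarrow> \<tau> j = j"
  by (rule permutes_not_in[OF weyl_permutes[OF tau_weyl]])

lemma tau_inj: "\<tau> i = \<tau> j \<longleftrightarrow> i = j"
  by (rule inj_eq[OF inj_weyl[OF tau_weyl]])

lemma r_binary: "j \<in> {1..2*n} \<Longrightarrow> r j = 0 \<or> r j = 1"
  using spinor by (simp add: binary_spinor_def)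

lemma r_star: "j \<in> {1..2*n} \<Longrightarrow> r (star n j) = 1 - r j"
  using spinor by (simp add: binary_spinor_def algebra_simps)

lemma r_outside: "j \<notin> {1..2*n} \<Longrightarrow> r j = 0"
  using spinor unfolding binary_spinor_def vecs_def by blast

text \<open>\<open>omega i\<close> increases weakly from -1 to 0 along the indices, so its
  contribution is -1 or 0 at a descent, where r is 1, and 0 or 1 at an ascent, where r is 0.\<close>

lemma mu_vec_binary:
  assumes "j \<in> {1..2*n}"
  shows "mu_vec (r, \<sigma>) i j \<in> {0, 1}"
  using r_binary[OF assms] descent[OF assms] ascent[OF assms] tau_in[OF assms] assms
  by (cases "\<tau> j" j rule: linorder_cases) (auto simp: mu_vec_apply omega_def)

lemma mu_vec_outside: "j \<notin> {1..2*n} \<Longrightarrow> mu_vec (r, \<sigma>) i j = 0"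
  using tau_outside r_outside by (simp add: mu_vec_apply)

lemma mu_vec_in_vecs: "mu_vec (r, \<sigma>) i \<in> vecs n"
  using mu_vec_outside by (simp add: vecs_def)

text \<open>The omega terms cancel because \<open>\<tau>\<close> permutes the indices. This total
  later makes the number of half-integral coordinates even.\<close>

lemma mu_vec_star_sum: "(\<Sum>j=1..n. mu_vec (r, \<sigma>) i j + mu_vec (r, \<sigma>) i (star n j)) = int n"
proof -
  have "(\<Sum>j=1..2*n. omega i (\<tau> j)) = (\<Sum>j=1..2*n. omega i j)"
    using sum.permute[OF weyl_permutes[OF tau_weyl], of "omega i"] by (simp add: o_def)
  then have "(\<Sum>j=1..2*n. mu_vec (r, \<sigma>) i j) = (\<Sum>j=1..2*n. r j)"
    by (simp add: mu_vec_apply sum.distrib sum_subtractf)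
  then show ?thesis
    using r_star sum_star_pairs[of "mu_vec (r, \<sigma>) i" n] sum_star_pairs[of r n] by simp
qed

lemma mu_vec_0: "mu_vec (r, \<sigma>) 0 = r"
  by (rule ext) (simp add: mu_vec_apply omega_def)

lemma totally_isotropic_0: "totally_isotropic n (mu_vec (r, \<sigma>) 0)"
  using r_star by (simp add: totally_isotropic_def mu_vec_0)

lemma omega_n_star: "j \<in> {1..2*n} \<Longrightarrow> omega n (star n j) = - 1 - omega n j"
  by (auto simp: omega_def star_def)

text \<open>The pair sums of \<open>omega n\<close> are constantly -1, so they cancel between
  \<open>omega n (\<tau> j)\<close> and \<open>omega n j\<close>, leaving those of r.\<close>

lemma totally_isotropic_n: "totally_isotropic n (mu_vec (r, \<sigma>) n)"
  using r_star tau_in tau_star by (simp add: totally_isotropic_def mu_vec_apply omega_n_star)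

lemma totally_isotropic_spinor:
  assumes "totally_isotropic n (mu_vec (r, \<sigma>) i)"
  shows "binary_spinor n (mu_vec (r, \<sigma>) i)"
proof -
  have "mu_vec (r, \<sigma>) i j + mu_vec (r, \<sigma>) i (star n j) = 1" if "j \<in> {1..2*n}" for j
    using assms that unfolding totally_isotropic_def by (metis diff_add_cancel)
  then show ?thesis
    unfolding binary_spinor_def using mu_vec_binary mu_vec_in_vecs by blast
qed

text \<open>Ties the spin condition at n to the sign of \<open>\<sigma>\<close>:
  \<open>omega n\<close> is -1 on the whole first half, so its two terms cancel except at crossings
  of \<open>\<tau>\<close>.\<close>

lemma mu_vec_n_half_sum:
  "(\<Sum>j=1..n. mu_vec (r, \<sigma>) n j) = (\<Sum>j=1..n. r j) + int (crossings n \<tau>)"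
proof -
  have "mu_vec (r, \<sigma>) n j = r j + (if \<tau> j > n then 1 else 0)" if "j \<in> {1..n}" for j
    using that tau_in[of j] by (auto simp: mu_vec_apply omega_def)
  then have "(\<Sum>j=1..n. mu_vec (r, \<sigma>) n j) = (\<Sum>j=1..n. r j + (if \<tau> j > n then 1 else 0))"
    by (intro sum.cong) auto
  then show ?thesis by (simp add: sum.distrib crossings_def sum.If_cases Int_def)
qed

end

lemma GL_permissible_iff:
  assumes w: "(r, \<sigma>) \<in> carrier (iw_group n)" and n: "n \<ge> 1"
  shows "GL_permissible n (r, \<sigma>) \<longleftrightarrow> gl_permissible_iw n r \<sigma>"
proof
  let ?\<tau> = "inv_into UNIV \<sigma>"
  have rw: "r \<in> cochars n" "\<sigma> \<in> weyl n" using w by (auto simp: iw_group_def)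
  have act: "iw_act (r, \<sigma>) (omega i) j = r j + omega i (?\<tau> j)" for i j
    by (simp add: iw_act_def of_int_vec_def perm_act_def)
  {
    assume GL: "GL_permissible n (r, \<sigma>)"
    have h: "omega i j \<le> r j + omega i (?\<tau> j)" "r j + omega i (?\<tau> j) \<le> omega i j + 1"
      if "i \<le> 2*n-1" "j \<in> {1..2*n}" for i j
      using GL that by (auto simp: GL_permissible_def act)
    obtain c where "r \<in> vecs n" and c: "\<forall>i\<in>{1..2*n}. r i + r (star n i) = c"
      using rw(1) by (auto simp: cochars_iff)
    have "int n = (\<Sum>j=1..2*n. r j)" using GL unfolding GL_permissible_def act by (simp add: omega_0)
    also have "\<dots> = int n * c" using c sum_star_pairs[of r n] by simp
    finally have "c = 1" using n by simp
    have bin: "r j \<in> {0, 1}" if "j \<in> {1..2*n}" for j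
      using h[of 0 j] that by (auto simp: omega_def)
    show "gl_permissible_iw n r \<sigma>"
    proof
      show "binary_spinor n r"
        using bin c \<open>c = 1\<close> \<open>r \<in> vecs n\<close> by (simp add: binary_spinor_def)
      fix j assume j: "j \<in> {1..2*n}"
      have t: "?\<tau> j \<in> {1..2*n}" by (rule weyl_in[OF weyl_inv[OF rw(2)] j])
      show "r j = 1" if "?\<tau> j < j"
      proof -
        \<comment> \<open>The index i = \<open>?\<tau> j\<close> separates the positions:
          \<open>omega i\<close> is -1 at \<open>?\<tau> j\<close> and 0 at j. For an ascent, i = j
          does the same; both indices are below 2n.\<close>
        have "?\<tau> j \<le> 2*n - 1" using that j by simp
        from h(1)[OF this j] show ?thesis using bin[OF j] that t j by (auto simp: omega_def)
      qed
      show "r j = 0" if "?\<tau> j > j"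
      proof -
        have "j \<le> 2*n - 1" using that t by simp
        from h(2)[OF this j] show ?thesis using bin[OF j] that t j by (auto simp: omega_def)
      qed
    qed (rule rw(2))
  next
    assume "gl_permissible_iw n r \<sigma>"
    then interpret gl_permissible_iw n r \<sigma> .
    have "mu_vec (r, \<sigma>) i j = iw_act (r, \<sigma>) (omega i) j - omega i j" for i j
      by (simp add: mu_vec_def)
    then have "omega i j \<le> iw_act (r, \<sigma>) (omega i) j \<and> iw_act (r, \<sigma>) (omega i) j \<le> omega i j + 1"
      if "j \<in> {1..2*n}" for i j
      using mu_vec_binary[OF that, of i] by auto
    moreover have "(\<Sum>j=1..2*n. iw_act (r, \<sigma>) (omega 0) j) = int n"
      using mu_vec_star_sum[of 0] sum_star_pairs[of r n] by (simp add: mu_vec_0 act omega_0)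
    ultimately show "GL_permissible n (r, \<sigma>)" by (simp add: GL_permissible_def)
  }
qed

section \<open>Half-integral displacements as midpoints of orbit vectors\<close>

definition spinor_extend :: "nat \<Rightarrow> (nat \<Rightarrow> int) \<Rightarrow> nat \<Rightarrow> int" where
  "spinor_extend n f =
    (\<lambda>j. if j \<in> {1..n} then f j else if j \<in> {n+1..2*n} then 1 - f (star n j) else 0)"

lemma binary_spinor_extend:
  assumes "\<And>j. j \<in> {1..n} \<Longrightarrow> f j \<in> {0, 1}"
  shows "binary_spinor n (spinor_extend n f)"
proof -
  have "spinor_extend n f j \<in> {0, 1}" if "j \<in> {1..2*n}" for j
  proof (cases "j \<le> n")
    case False
    then have "star n j \<in> {1..n}" using that by (auto simp: star_def)
    from assms[OF this] show ?thesis using False that by (auto simp: spinor_extend_def)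
  qed (use assms that in \<open>auto simp: spinor_extend_def\<close>)
  moreover have "spinor_extend n f j + spinor_extend n f (star n j) = 1" if "j \<in> {1..2*n}" for j
    using that star_star[OF that] by (auto simp: spinor_extend_def star_def)
  moreover have "spinor_extend n f \<in> vecs n" by (auto simp: spinor_extend_def vecs_def)
  ultimately show ?thesis by (simp add: binary_spinor_def)
qed

lemma half_sum_spinor_extend: "(\<Sum>j=1..n. spinor_extend n f j) = (\<Sum>j=1..n. f j)"
  by (simp add: spinor_extend_def)

text \<open>Average of m with its dual vector, whose entry at j is 1 - \<open>m (star n j)\<close>:
  a projection to pair sums 1.\<close>

definition isotropic_part :: "nat \<Rightarrow> (nat \<Rightarrow> int) \<Rightarrow> nat \<Rightarrow> real" where
  "isotropic_part n m =
    (\<lambda>j. if j \<in> {1..2*n} then (of_int (m j) + 1 - of_int (m (star n j))) / 2 else 0)"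

lemma isotropic_part_eq:
  assumes "m \<in> vecs n" "totally_isotropic n m"
  shows "isotropic_part n m = of_int_vec m"
proof
  fix j
  show "isotropic_part n m j = of_int_vec m j"
  proof (cases "j \<in> {1..2*n}")
    case True
    then have "m j = 1 - m (star n j)" using assms(2) unfolding totally_isotropic_def by blast
    then have "real_of_int (m j) = 1 - of_int (m (star n j))" by simp
    then show ?thesis using True by (simp add: isotropic_part_def of_int_vec_def)
  next
    case False
    then have "m j = 0" using assms(1) unfolding vecs_def by blast
    then show ?thesis using False by (auto simp: isotropic_part_def of_int_vec_def)
  qed
qed

text \<open>H collects the first-half positions with coordinate 1/2. The endpoints f and f' equal m
  off H and are complementary on H; evenness of H gives them equal parity, and one bit at h in H
  adjusts it to that of \<open>\<mu>\<close>.\<close>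

lemma isotropic_part_in_hull:
  assumes \<mu>: "binary_spinor n \<mu>" and m: "m \<in> vecs n"
    and bin: "\<And>j. j \<in> {1..2*n} \<Longrightarrow> m j \<in> {0, 1}"
    and sum: "(\<Sum>j=1..n. m j + m (star n j)) = int n"
    and spin: "totally_isotropic n m \<Longrightarrow> m \<in> weyl0_orbit n \<mu>"
  shows "isotropic_part n m \<in> convex hull (of_int_vec ` weyl0_orbit n \<mu>)"
proof (cases "totally_isotropic n m")
  case True
  then show ?thesis using isotropic_part_eq[OF m] spin by (simp add: hull_inc)
next
  case False
  define H where "H = {j \<in> {1..n}. m j = m (star n j)}"
  have bin2: "m j = 0 \<or> m j = 1" "m (star n j) = 0 \<or> m (star n j) = 1" if "j \<in> {1..2*n}" for j
    using bin[OF that] bin[OF star_in[OF that]] by auto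
  have Hn: "H \<subseteq> {1..n}" by (auto simp: H_def)
  obtain k where k: "k \<in> {1..2*n}" "m k \<noteq> 1 - m (star n k)"
    using False unfolding totally_isotropic_def by blast
  have "m k = m (star n k)" using k bin2[OF k(1)] by auto
  then have "fold_star n k \<in> H"
    using k by (auto simp: H_def fold_star_def star_star) (auto simp: star_def)
  then obtain h where h: "h \<in> H" by blast
  have cardH: "int (card H) = (\<Sum>j=1..n. if j \<in> H then 1 else 0)"
    using Hn by (simp add: sum.If_cases inf_absorb2)
  \<comment> \<open>Pair sum minus 1 is odd exactly on H, and these differences add up to n - n =
    0.\<close>
  have evenH: "even (card H)"
  proof -
    have "even (m j + m (star n j) - 1 - (if j \<in> H then 1 else 0))" if "j \<in> {1..n}" for j
      using bin2[of j] that by (auto simp: H_def)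
    then have "even (\<Sum>j=1..n. m j + m (star n j) - 1 - (if j \<in> H then 1 else 0))"
      by (rule dvd_sum)
    also have "(\<Sum>j=1..n. m j + m (star n j) - 1 - (if j \<in> H then 1 else 0)) = - int (card H)"
      unfolding sum_subtractf cardH sum by simp
    finally show ?thesis by simp
  qed
  define b :: int where
    "b = (if even (\<Sum>j\<in>{1..n}-{h}. m j) \<longleftrightarrow> even (\<Sum>j=1..n. \<mu> j) then 0 else 1)"
  define f where "f = (\<lambda>j. if j = h then b else m j)"
  define f' where "f' = (\<lambda>j. if j \<in> H then 1 - f j else f j)"
  have f: "f j \<in> {0, 1}" if "j \<in> {1..n}" for j using bin2[of j] that by (auto simp: f_def b_def)
  then have f': "f' j \<in> {0, 1}" if "j \<in> {1..n}" for j using that by (auto simp: f'_def)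
  have "(\<Sum>j=1..n. f j) = f h + (\<Sum>j\<in>{1..n}-{h}. f j)"
    using h Hn by (intro sum.remove) auto
  also have "(\<Sum>j\<in>{1..n}-{h}. f j) = (\<Sum>j\<in>{1..n}-{h}. m j)" by (intro sum.cong) (auto simp: f_def)
  finally have parity: "even (\<Sum>j=1..n. f j) \<longleftrightarrow> even (\<Sum>j=1..n. \<mu> j)"
    by (auto simp: f_def b_def)
  have "even (f' j - f j - (if j \<in> H then 1 else 0))" for j
    by (auto simp: f'_def)
  then have "even (\<Sum>j=1..n. f' j - f j - (if j \<in> H then 1 else 0))"
    by (intro dvd_sum)
  then have "even ((\<Sum>j=1..n. f' j) - (\<Sum>j=1..n. f j))"
    unfolding sum_subtractf cardH[symmetric] using evenH by simp
  then have parity': "even (\<Sum>j=1..n. f' j) \<longleftrightarrow> even (\<Sum>j=1..n. \<mu> j)"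
    using parity by simp
  let ?v = "of_int_vec (spinor_extend n f) :: nat \<Rightarrow> real"
  let ?v' = "of_int_vec (spinor_extend n f') :: nat \<Rightarrow> real"
  have "spinor_extend n f \<in> weyl0_orbit n \<mu>" "spinor_extend n f' \<in> weyl0_orbit n \<mu>"
    using parity parity' f f'
    by (simp_all only: weyl0_orbit_iff[OF \<mu>] binary_spinor_extend half_sum_spinor_extend)
  then have "(1/2) *\<^sub>R ?v + (1/2) *\<^sub>R ?v' \<in> convex hull (of_int_vec ` weyl0_orbit n \<mu>)"
    by (intro convexD[OF convex_convex_hull] hull_inc imageI) auto
  also have "(1/2) *\<^sub>R ?v + (1/2) *\<^sub>R ?v' = isotropic_part n m"
  proof
    fix j
    have low: "of_int (f i) + real_of_int (f' i) = of_int (m i) + 1 - of_int (m (star n i))"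
      if "i \<in> {1..n}" for i
      using bin2[of i] that h by (auto simp: f_def f'_def H_def)
    consider "j \<in> {1..n}" | "j \<in> {n+1..2*n}" | "j \<notin> {1..2*n}" by fastforce
    then show "((1/2) *\<^sub>R ?v + (1/2) *\<^sub>R ?v') j = isotropic_part n m j"
    proof cases
      case 1
      then show ?thesis using low[OF 1]
        by (simp add: scaleR_fun_def of_int_vec_def spinor_extend_def isotropic_part_def)
    next
      case 2
      then have "star n j \<in> {1..n}" "star n (star n j) = j" by (auto simp: star_def)
      then show ?thesis using low[of "star n j"] 2
        by (simp add: scaleR_fun_def of_int_vec_def spinor_extend_def isotropic_part_def diff_divide_distrib add_divide_distrib)
    next
      case 3
      then show ?thesis
        by (auto simp: scaleR_fun_def of_int_vec_def spinor_extend_def isotropic_part_def)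
    qed
  qed
  finally show ?thesis .
qed

section \<open>Displacements of alcove vertices\<close>

text \<open>By \<open>half_sum_weyl_cong\<close> with c = 0 the correction has even half sum, so the
  parity class survives and only the range of the entries has to be checked.\<close>

lemma orbit_shift:
  assumes \<mu>: "binary_spinor n \<mu>" and m: "m \<in> weyl0_orbit n \<mu>" and w: "\<tau> \<in> weyl n"
    and v: "v \<in> vecs n" "\<And>j. j \<in> {1..2*n} \<Longrightarrow> v j + v (star n j) = 0"
    and bin: "\<And>j. j \<in> {1..2*n} \<Longrightarrow> m j + v (\<tau> j) - v j \<in> {0, 1}"
  shows "(\<lambda>j. m j + v (\<tau> j) - v j) \<in> weyl0_orbit n \<mu>"
proof -
  let ?m = "\<lambda>j. m j + v (\<tau> j) - v j"
  have ms: "binary_spinor n m" "even (\<Sum>j=1..n. m j) \<longleftrightarrow> even (\<Sum>j=1..n. \<mu> j)"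
    using m weyl0_orbit_iff[OF \<mu>] by auto
  have "?m j = 0" if "j \<notin> {1..2*n}" for j
  proof -
    have "\<tau> j = j" using permutes_not_in[OF weyl_permutes[OF w] that] .
    moreover have "m j = 0" using ms(1) that unfolding binary_spinor_def vecs_def by blast
    ultimately show ?thesis by simp
  qed
  then have "?m \<in> vecs n" by (simp add: vecs_def)
  moreover have "?m j + ?m (star n j) = 1" if j: "j \<in> {1..2*n}" for j
  proof -
    have "m j + m (star n j) = 1" using ms(1) j unfolding binary_spinor_def by blast
    then show ?thesis
      using v(2)[OF j] v(2)[OF weyl_in[OF w j]] weyl_star[OF w j] by simp
  qed
  ultimately have "binary_spinor n ?m" using bin unfolding binary_spinor_def by blast
  moreover have "even ((\<Sum>j=1..n. v (\<tau> j)) - (\<Sum>j=1..n. v j))"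
    using half_sum_weyl_cong[OF w, of v 0] v(2) by simp
  then have "even (\<Sum>j=1..n. ?m j) \<longleftrightarrow> even (\<Sum>j=1..n. \<mu> j)"
    using ms(2) by (auto simp: sum.distrib sum_subtractf)
  ultimately show ?thesis using weyl0_orbit_iff[OF \<mu>] by blast
qed

lemma convex_displacement:
  assumes "convex S"
  shows "convex {x :: nat \<Rightarrow> real. iw_act w x - x \<in> S}"
proof (rule convexI)
  fix x y :: "nat \<Rightarrow> real" and u v :: real
  assume h: "x \<in> {x. iw_act w x - x \<in> S}" "y \<in> {x. iw_act w x - x \<in> S}" and uv: "0 \<le> u" "0 \<le> v" "u + v = 1"
  obtain r \<sigma> where w: "w = (r, \<sigma>)" by (cases w)
  have "iw_act w (u *\<^sub>R x + v *\<^sub>R y) - (u *\<^sub>R x + v *\<^sub>R y)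
      = u *\<^sub>R (iw_act w x - x) + v *\<^sub>R (iw_act w y - y)"
  proof
    fix j
    have "real_of_int (r j) = u * of_int (r j) + v * of_int (r j)"
      using uv(3) by (metis distrib_right mult_1)
    then show "(iw_act w (u *\<^sub>R x + v *\<^sub>R y) - (u *\<^sub>R x + v *\<^sub>R y)) j
      = (u *\<^sub>R (iw_act w x - x) + v *\<^sub>R (iw_act w y - y)) j"
      unfolding w displacement_apply plus_fun_apply scaleR_fun_def
      by (simp add: algebra_simps)
  qed
  then show "u *\<^sub>R x + v *\<^sub>R y \<in> {x. iw_act w x - x \<in> S}"
    using convexD[OF assms _ _ uv] h by simp
qed

text \<open>For i \<le> n this is the mean of \<open>omega i\<close> and
  \<open>omega (2*n - i)\<close>, moved by the constant 1/2 on all 2n coordinates; this makes pair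
  sums vanish and does not affect displacements.\<close>

definition alcove_point :: "nat \<Rightarrow> nat \<Rightarrow> nat \<Rightarrow> real" where
  "alcove_point n i =
    (\<lambda>j. if j \<in> {1..2*n} then (of_int (omega i j) - of_int (omega i (star n j))) / 2 else 0)"

text \<open>Pair sums are 0, but for i in the first half the half sum is 1: adding it flips
  parity.\<close>

definition pair_vec :: "nat \<Rightarrow> nat \<Rightarrow> nat \<Rightarrow> int" where
  "pair_vec n i = (\<lambda>j. if j = i then 1 else if j = star n i then -1 else 0)"

lemma pair_vec_star:
  assumes "i \<in> {1..n}" "j \<in> {1..2*n}"
  shows "pair_vec n i j + pair_vec n i (star n j) = 0"
  using assms by (auto simp: pair_vec_def star_def)

lemma pair_vec_in_vecs: "i \<in> {1..n} \<Longrightarrow> pair_vec n i \<in> vecs n"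
  by (auto simp: pair_vec_def vecs_def star_def)

context gl_permissible_iw
begin

text \<open>\<open>alcove_point n i\<close> antisymmetrises \<open>omega i\<close> under star,
  \<open>\<tau>\<close> commutes with star and r has pair sums 1, so the displacement averages
  \<open>mu_vec\<close> with its dual.\<close>

lemma displacement_alcove_point:
  "iw_act (r, \<sigma>) (alcove_point n i) - alcove_point n i = isotropic_part n (mu_vec (r, \<sigma>) i)"
proof
  fix j
  show "(iw_act (r, \<sigma>) (alcove_point n i) - alcove_point n i) j
    = isotropic_part n (mu_vec (r, \<sigma>) i) j"
  proof (cases "j \<in> {1..2*n}")
    case True
    show ?thesis
      unfolding displacement_apply using True tau_in[OF True] tau_star[OF True] r_star[OF True]
      by (simp add: alcove_point_def isotropic_part_def mu_vec_apply field_simps)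
  next
    case False
    then show ?thesis
      unfolding displacement_apply using tau_outside[OF False] r_outside[OF False]
      by (auto simp: alcove_point_def isotropic_part_def)
  qed
qed

text \<open>From i - 1 to i, omega drops at position i alone; under a flip, its permuted copy drops
  at \<open>star n i\<close> alone.\<close>

lemma mu_vec_step:
  assumes i: "i \<in> {1..n}" and flip: "\<tau> i = star n i"
  shows "mu_vec (r, \<sigma>) i j = mu_vec (r, \<sigma>) (i - 1) j + pair_vec n i j"
proof -
  have "\<tau> (star n i) = i" using tau_star[of i] i flip by (simp add: star_star)
  then have "\<tau> j = i \<longleftrightarrow> j = star n i" using tau_inj[of j "star n i"] by simp
  moreover have "star n i \<noteq> i" using i by (auto simp: star_def)
  moreover have "omega i k = omega (i - 1) k - (if k = i then 1 else 0)" for k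
    using i by (auto simp: omega_def)
  ultimately show ?thesis by (auto simp: mu_vec_apply pair_vec_def)
qed

end

locale spin_permissible_iw = gl_permissible_iw +
  fixes \<mu> :: "nat \<Rightarrow> int"
  assumes mu_spinor: "binary_spinor n \<mu>"
    and spin: "i \<le> n \<Longrightarrow> totally_isotropic n (mu_vec (r, \<sigma>) i) \<Longrightarrow>
      mu_vec (r, \<sigma>) i \<in> weyl0_orbit n \<mu>"
begin

abbreviation hull_orbit :: "(nat \<Rightarrow> real) set" where
  "hull_orbit \<equiv> convex hull (of_int_vec ` weyl0_orbit n \<mu>)"

lemma alcove_point_displacement_in_hull:
  assumes "i \<le> n"
  shows "iw_act (r, \<sigma>) (alcove_point n i) - alcove_point n i \<in> hull_orbit"
  unfolding displacement_alcove_point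
  using mu_vec_in_vecs mu_vec_binary mu_vec_star_sum spin[OF assms]
  by (rule isotropic_part_in_hull[OF mu_spinor])

text \<open>A flip at \<open>i\<close> would make \<open>mu_vec (r, \<sigma>) (i - 1)\<close> and \<open>mu_vec (r, \<sigma>) i\<close> totally isotropic of
  opposite parity.\<close>

lemma no_flip:
  assumes i: "i \<in> {1..n}"
    and iso: "totally_isotropic n (mu_vec (r, \<sigma>) (i - 1)) \<or> totally_isotropic n (mu_vec (r, \<sigma>) i)"
  shows "\<tau> i \<noteq> star n i"
proof
  assume flip: "\<tau> i = star n i"
  let ?a = "mu_vec (r, \<sigma>) (i - 1)" and ?b = "mu_vec (r, \<sigma>) i"
  have step: "?b j = ?a j + pair_vec n i j" for j by (rule mu_vec_step[OF i flip])
  have "?b j = 1 - ?b (star n j) \<longleftrightarrow> ?a j = 1 - ?a (star n j)" if "j \<in> {1..2*n}" for j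
    using pair_vec_star[OF i that] step[of j] step[of "star n j"] by linarith
  then have "totally_isotropic n ?a \<longleftrightarrow> totally_isotropic n ?b"
    by (simp add: totally_isotropic_def)
  with iso have "?a \<in> weyl0_orbit n \<mu>" "?b \<in> weyl0_orbit n \<mu>"
    using spin[of i] spin[of "i - 1"] i by auto
  then have "even (\<Sum>j=1..n. ?a j) \<longleftrightarrow> even (\<Sum>j=1..n. ?b j)"
    using weyl0_orbit_iff[OF mu_spinor] by blast
  moreover have "(\<Sum>j=1..n. ?b j) = (\<Sum>j=1..n. ?a j) + (\<Sum>j=1..n. if j = i then 1 else 0)"
  proof -
    have "?b j = ?a j + (if j = i then 1 else 0)" if "j \<in> {1..n}" for j
      using that i step[of j] by (auto simp: pair_vec_def star_def)
    then show ?thesis by (simp add: sum.distrib)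
  qed
  ultimately show False using i by simp
qed

text \<open>Shifting the point by v changes the displacement by \<open>v (\<tau> j) - v j\<close>,
  to which \<open>orbit_shift\<close> applies. It is used with c = -1, k = 1 at
  \<open>alcove_point n 0\<close> and with c = 1, k = n at \<open>alcove_point n n\<close>.\<close>

lemma shifted_displacement_in_hull:
  fixes c :: int
  assumes i: "i \<le> n" "totally_isotropic n (mu_vec (r, \<sigma>) i)" and k: "k \<in> {1..n}"
    and bin: "\<And>j. j \<in> {1..2*n} \<Longrightarrow>
      mu_vec (r, \<sigma>) i j + c * pair_vec n k (\<tau> j) - c * pair_vec n k j \<in> {0, 1}"
  defines "x \<equiv> \<lambda>j. alcove_point n i j + of_int (c * pair_vec n k j)"
  shows "iw_act (r, \<sigma>) x - x \<in> hull_orbit"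
proof -
  let ?m = "\<lambda>j. mu_vec (r, \<sigma>) i j + c * pair_vec n k (\<tau> j) - c * pair_vec n k j"
  have "?m \<in> weyl0_orbit n \<mu>"
  proof (rule orbit_shift[OF mu_spinor spin[OF i] tau_weyl])
    show "(\<lambda>j. c * pair_vec n k j) \<in> vecs n" using pair_vec_in_vecs[OF k] by (simp add: vecs_def)
    show "c * pair_vec n k j + c * pair_vec n k (star n j) = 0" if "j \<in> {1..2*n}" for j
      using pair_vec_star[OF k that] by (metis distrib_left mult_zero_right)
  qed (rule bin)
  moreover have "iw_act (r, \<sigma>) x - x = of_int_vec ?m"
  proof
    fix j
    have "(iw_act (r, \<sigma>) (alcove_point n i) - alcove_point n i) j = of_int (mu_vec (r, \<sigma>) i j)"
      by (simp add: displacement_alcove_point isotropic_part_eq[OF mu_vec_in_vecs i(2)] of_int_vec_def)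
    then show "(iw_act (r, \<sigma>) x - x) j = of_int_vec ?m j"
      unfolding displacement_apply x_def of_int_vec_def by simp
  qed
  ultimately show ?thesis by (simp add: hull_inc)
qed

text \<open>By descent and ascent the entries stay in range unless \<open>\<tau>\<close> exchanges 1
  and \<open>star n 1\<close>, where the shift is extreme; \<open>no_flip\<close> excludes this
  because \<open>mu_vec\<close> at 0 is totally isotropic.\<close>

lemma first_vertex_displacement_in_hull:
  assumes n: "n \<ge> 1"
  defines "x \<equiv> \<lambda>j. alcove_point n 0 j + of_int ((-1) * pair_vec n 1 j)"
  shows "iw_act (r, \<sigma>) x - x \<in> hull_orbit"
  unfolding x_def
proof (rule shifted_displacement_in_hull)
  show "totally_isotropic n (mu_vec (r, \<sigma>) 0)" by (rule totally_isotropic_0)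
  fix j assume j: "j \<in> {1..2*n}"
  have one: "\<tau> 1 \<noteq> star n 1" using no_flip[of 1] totally_isotropic_0 n by simp
  have "\<tau> (star n 1) \<noteq> 1"
  proof
    assume "\<tau> (star n 1) = 1"
    then have "star n (\<tau> 1) = 1" using tau_star[of 1] n by simp
    then show False using one star_star[of "\<tau> 1" n] tau_in[of 1] n by simp
  qed
  then show "mu_vec (r, \<sigma>) 0 j + - 1 * pair_vec n 1 (\<tau> j) - - 1 * pair_vec n 1 j \<in> {0, 1}"
    unfolding mu_vec_0 using one j tau_in[OF j] r_binary[OF j] descent[OF j] ascent[OF j]
    by (cases "\<tau> j" j rule: linorder_cases) (auto simp: pair_vec_def star_def split: if_splits)
qed (use n in auto)

text \<open>The shift interchanges the entries of \<open>omega n\<close> at n and n + 1 =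
  \<open>star n n\<close>; monotonicity fails only between these two, so only a flip at n could
  leave the range.\<close>

lemma last_vertex_displacement_in_hull:
  assumes n: "n \<ge> 1"
  defines "x \<equiv> \<lambda>j. alcove_point n n j + of_int (1 * pair_vec n n j)"
  shows "iw_act (r, \<sigma>) x - x \<in> hull_orbit"
  unfolding x_def
proof (rule shifted_displacement_in_hull)
  show "totally_isotropic n (mu_vec (r, \<sigma>) n)" by (rule totally_isotropic_n)
  fix j assume j: "j \<in> {1..2*n}"
  have one: "\<tau> n \<noteq> star n n" using no_flip[of n] totally_isotropic_n n by simp
  have two: "\<tau> (star n n) \<noteq> n"
  proof
    assume "\<tau> (star n n) = n"
    then have "star n (\<tau> n) = n" using tau_star[of n] n by simp
    then show False using one star_star[of "\<tau> n" n] tau_in[of n] n by simp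
  qed
  have s: "star n n = Suc n" by (simp add: star_def)
  have "omega n k + pair_vec n n k = (if k \<in> {1..n-1} \<or> k = Suc n then -1 else 0)" for k
    using n by (auto simp: omega_def pair_vec_def s)
  then have eq: "mu_vec (r, \<sigma>) n j + 1 * pair_vec n n (\<tau> j) - 1 * pair_vec n n j
      = r j + (if \<tau> j \<in> {1..n-1} \<or> \<tau> j = Suc n then -1 else 0)
        - (if j \<in> {1..n-1} \<or> j = Suc n then -1 else 0)"
    unfolding mu_vec_apply by (smt (verit))
  have excl: "\<not> (\<tau> j = n \<and> j = Suc n)" "\<not> (\<tau> j = Suc n \<and> j = n)"
    using one two by (auto simp: s)
  have t: "1 \<le> \<tau> j" using tau_in[OF j] by simp
  show "mu_vec (r, \<sigma>) n j + 1 * pair_vec n n (\<tau> j) - 1 * pair_vec n n j \<in> {0, 1}"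
  proof (cases "\<tau> j" j rule: linorder_cases)
    case less
    moreover have "\<tau> j \<in> {1..n-1} \<or> \<tau> j = Suc n" if "j \<in> {1..n-1} \<or> j = Suc n"
      using less excl(1) t that by auto
    ultimately show ?thesis unfolding eq using descent[OF j] by simp
  next
    case equal
    then show ?thesis unfolding eq using r_binary[OF j] by simp
  next
    case greater
    moreover have "j \<in> {1..n-1} \<or> j = Suc n" if "\<tau> j \<in> {1..n-1} \<or> \<tau> j = Suc n"
      using greater excl(2) j that by auto
    ultimately show ?thesis unfolding eq using ascent[OF j] by auto
  qed
qed (use n in auto)

end

section \<open>Alcove points as convex combinations of vertices\<close>

lemma alcove_point_low: "i \<le> n \<Longrightarrow> j \<in> {1..n} \<Longrightarrow> alcove_point n i j = (if j \<le> i then - 1/2 else 0)"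
  by (auto simp: alcove_point_def omega_def star_def)

lemma alcove_point_antisym:
  "j \<in> {1..2*n} \<Longrightarrow> alcove_point n i (star n j) = - alcove_point n i j"
  using star_in[of j n] by (simp add: alcove_point_def star_star field_simps)

text \<open>\<open>Y\<close> folds \<open>y\<close> by the symmetries \<open>y\<^sub>1 \<mapsto> -1 - y\<^sub>1\<close> and \<open>y\<^sub>n \<mapsto> -y\<^sub>n\<close> into the (smaller) alcove of type
  \<open>C\<^sub>n\<close>, whose vertices are the points \<open>alcove_point n i\<close> and whose barycentric coordinates are the
  doubled increments of \<open>Y\<close>; unfolding replaces the first and the last vertex by their mirror images.\<close>

lemma alcove_in_convex:
  fixes y :: "nat \<Rightarrow> real"
  assumes n: "n \<ge> 2" and S: "convex S"
    and vertex: "\<And>i. i \<le> n \<Longrightarrow> alcove_point n i \<in> S"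
    and first: "(\<lambda>j. alcove_point n 0 j + of_int ((-1) * pair_vec n 1 j)) \<in> S"
    and last: "(\<lambda>j. alcove_point n n j + of_int (1 * pair_vec n n j)) \<in> S"
    and y: "y \<in> vecs n" "\<And>j. j \<in> {1..2*n} \<Longrightarrow> y (star n j) = - y j"
    and incr: "\<And>i. 1 \<le> i \<Longrightarrow> i < n \<Longrightarrow> y i \<le> y (i + 1)"
    and walls: "y (n - 1) + y n \<le> 0" "y 1 + y 2 \<ge> -1" "y 1 - y 2 \<ge> -1"
  shows "y \<in> S"
proof -
  \<comment> \<open>The values -1/2 at 0 and 0 at n + 1 are the end walls of the type C alcove; with
    them the weights l telescope to 1.\<close>
  define Y where "Y = (\<lambda>i. if i = 0 then - 1/2 else if i = 1 then max (y 1) (- 1 - y 1)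
    else if i = n then - \<bar>y n\<bar> else if i = n + 1 then 0 else y i)"
  define l where "l = (\<lambda>i. 2 * (Y (Suc i) - Y i))"
  \<comment> \<open>The switches record which folds acted, so that p takes the mirror image of
    vertex 0 or n exactly then.\<close>
  define c0 where "c0 = (if y 1 < - 1/2 then -1 else 0 :: real)"
  define cn where "cn = (if y n > 0 then 1 else 0 :: real)"
  define p where "p = (\<lambda>i j. alcove_point n i j
    + (if i = 0 then c0 * of_int (pair_vec n 1 j) else 0)
    + (if i = n then cn * of_int (pair_vec n n j) else 0))"
  have p_in: "p i \<in> S" if "i \<le> n" for i
  proof -
    consider "i = 0" "y 1 < -1/2" | "i = n" "y n > 0"
      | "(i = 0 \<longrightarrow> \<not> y 1 < -1/2) \<and> (i = n \<longrightarrow> \<not> y n > 0)" by blast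
    then show ?thesis
    proof cases
      case 1
      then have "p i = (\<lambda>j. alcove_point n 0 j + of_int ((-1) * pair_vec n 1 j))"
        using n by (simp add: p_def c0_def)
      then show ?thesis using first by simp
    next
      case 2
      then have "p i = (\<lambda>j. alcove_point n n j + of_int (1 * pair_vec n n j))"
        using n by (simp add: p_def cn_def)
      then show ?thesis using last by simp
    next
      case 3
      then have "p i = alcove_point n i" by (auto simp: p_def c0_def cn_def)
      then show ?thesis using vertex[OF that] by simp
    qed
  qed
  have Y: "Y 0 = - 1/2" "Y 1 = max (y 1) (- 1 - y 1)" "Y n = - \<bar>y n\<bar>" "Y (Suc n) = 0"
    using n by (auto simp: Y_def)
  have Y_mid: "Y i = y i" if "1 < i" "i < n" for i using that by (auto simp: Y_def)
  have l_ends: "l 0 = 2 * Y 1 + 1" "l n = 2 * \<bar>y n\<bar>" using Y by (simp_all add: l_def)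
  have tele: "(\<Sum>i=j..n. l i) = - 2 * Y j" if "j \<le> n" for j
  proof -
    have "(\<Sum>i=j..n. l i) = 2 * (\<Sum>i=j..n. Y (Suc i) - Y i)"
      by (simp only: l_def sum_distrib_left)
    then show ?thesis using sum_Suc_diff[of j n Y] that Y(4) by simp
  qed
  have l_nonneg: "l i \<ge> 0" if "i \<le> n" for i
  proof -
    have "i = 0 \<or> i = n \<or> i = 1 \<and> (n = 2 \<or> n > 2) \<or> i > 1 \<and> (Suc i = n \<or> Suc i < n)"
      using that n by presburger
    then consider "i = 0" | "i = n" | "i = 1" "n = 2" | "i = 1" "n > 2"
      | "i > 1" "Suc i = n" | "i > 1" "Suc i < n"
      by blast
    then have "Y i \<le> Y (Suc i)"
    proof cases
      case 1 then show ?thesis using Y(1,2) by (simp add: max_def)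
    next
      case 2 then show ?thesis using Y(3,4) by simp
    next
      case 3
      \<comment> \<open>For n = 2 both folds meet: each of y 1 and -1 - y 1 must lie below both y 2
        and -y 2, which takes all four alcove inequalities.\<close>
      have "max (y 1) (- 1 - y 1) \<le> - \<bar>y n\<bar>" using 3(2) walls incr[of 1] by (auto simp: numeral_2_eq_2)
      then show ?thesis using 3 Y(2,3) by (simp add: numeral_2_eq_2)
    next
      case 4
      have "max (y 1) (- 1 - y 1) \<le> y 2" using 4(2) walls incr[of 1] by (simp add: numeral_2_eq_2)
      then show ?thesis using 4 Y(2) Y_mid[of 2] by (simp add: numeral_2_eq_2)
    next
      case 5
      then have "y i \<le> - \<bar>y n\<bar>" using walls(1) incr[of i] by auto
      then show ?thesis using 5 Y(3) Y_mid[of i] by simp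
    next
      case 6 then show ?thesis using incr[of i] Y_mid[of i] Y_mid[of "Suc i"] by simp
    qed
    then show ?thesis by (simp add: l_def)
  qed
  have "(\<Sum>i\<in>{0..n}. l i *\<^sub>R p i) \<in> S"
  proof (rule convex_sum[OF _ S])
    show "sum l {0..n} = 1" using tele[of 0] Y(1) by simp
  qed (use l_nonneg p_in in auto)
  also have "(\<Sum>i\<in>{0..n}. l i *\<^sub>R p i) = y"
  proof
    fix j
    define q where "q = (\<lambda>j. \<Sum>i\<in>{0..n}. l i * p i j)"
    have q: "q j = (\<Sum>i\<in>{0..n}. l i * alcove_point n i j)
      + l 0 * c0 * of_int (pair_vec n 1 j) + l n * cn * of_int (pair_vec n n j)" for j
    proof -
      have "l i * p i j = l i * alcove_point n i j
          + (if i = 0 then l 0 * c0 * of_int (pair_vec n 1 j) else 0)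
          + (if i = n then l n * cn * of_int (pair_vec n n j) else 0)" for i
        by (cases "i = 0"; cases "i = n") (simp_all add: p_def distrib_left mult.assoc)
      then show ?thesis by (simp add: q_def sum.distrib)
    qed
    have low: "q j = y j" if j: "j \<in> {1..n}" for j
    proof -
      have "(\<Sum>i\<in>{0..n}. l i * alcove_point n i j) = (\<Sum>i\<in>{0..n}. if j \<le> i then l i * (- 1/2) else 0)"
        by (rule sum.cong) (use j in \<open>auto simp: alcove_point_low\<close>)
      also have "\<dots> = (\<Sum>i=j..n. l i * (- 1/2))"
        by (rule sum.mono_neutral_cong_right) auto
      also have "\<dots> = (\<Sum>i=j..n. l i) * (- 1/2)" by (simp only: sum_distrib_right)
      also have "\<dots> = Y j" using tele[of j] j by simp
      finally have "q j = Y j + l 0 * c0 * of_int (pair_vec n 1 j) + l n * cn * of_int (pair_vec n n j)"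
        by (simp add: q)
      moreover have "pair_vec n i j = (if j = i then 1 else 0)" if "i \<in> {1..n}" for i
        using that j by (auto simp: pair_vec_def star_def)
      ultimately have "q j = Y j + (if j = 1 then l 0 * c0 else 0) + (if j = n then l n * cn else 0)"
        using n by simp
      \<comment> \<open>Undoing the folds: subtracting l 0 = 2 Y 1 + 1 turns -1 - y 1 back into y 1,
        and below, adding l n turns -y n back into y n.\<close>
      moreover have "Y 1 + l 0 * c0 = y 1" using l_ends(1) Y(2) by (simp add: c0_def max_def)
      moreover have "Y n + l n * cn = y n" using l_ends(2) Y(3) by (simp add: cn_def)
      moreover have "j = 1 \<or> j = n \<or> (1 < j \<and> j < n)" using j by auto
      ultimately show ?thesis using n Y_mid[of j] by auto
    qed
    have anti: "q (star n j) = - q j" if j: "j \<in> {1..2*n}" for j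
    proof -
      have "of_int (pair_vec n i (star n j)) = - real_of_int (pair_vec n i j)" if "i \<in> {1..n}" for i
        using pair_vec_star[OF that j] by linarith
      then show ?thesis using n by (simp add: q alcove_point_antisym[OF j] sum_negf)
    qed
    have "q j = y j"
    proof -
      consider "j \<in> {1..n}" | "j \<in> {n+1..2*n}" | "j \<notin> {1..2*n}" by fastforce
      then show ?thesis
      proof cases
        case 2
        then have s: "star n j \<in> {1..n}" and j: "j \<in> {1..2*n}" by (auto simp: star_def)
        show ?thesis using low[OF s] anti[OF j] y(2)[OF j] by simp
      next
        case 3
        then have "y j = 0" using y(1) unfolding vecs_def by blast
        moreover have "pair_vec n i j = 0" if "i \<in> {1..n}" for i
          using pair_vec_in_vecs[OF that] 3 unfolding vecs_def by blast
        moreover have "alcove_point n i j = 0" for i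
          using 3 unfolding alcove_point_def by (rule if_not_P)
        ultimately show ?thesis using n by (simp add: q)
      qed (rule low)
    qed
    then show "(\<Sum>i\<in>{0..n}. l i *\<^sub>R p i) j = y j"
      by (simp add: sum_fun_apply scaleR_fun_def q_def)
  qed
  finally show ?thesis .
qed

lemma (in spin_permissible_iw) displacement_in_hull:
  assumes n: "n \<ge> 2" and x: "x \<in> base_alcove n"
  shows "iw_act (r, \<sigma>) x - x \<in> hull_orbit"
proof -
  obtain c where c: "\<forall>i\<in>{1..2*n}. x i + x (star n i) = c"
    using x by (auto simp: base_alcove_def cochars_iff)
  have x_vec: "x \<in> vecs n" using x by (simp add: base_alcove_def cochars_def)
  have wall: "-1 < x i - x j \<and> x i - x j < 0"
    if "i \<in> {1..2*n}" "j \<in> {1..2*n}" "i < j" "j \<noteq> star n i" for i j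
    using x that unfolding base_alcove_def by blast
  \<comment> \<open>Removing half the pair sum makes pair sums 0; constants are fixed by
    permutations, so the displacement stays the same.\<close>
  define y where "y = (\<lambda>j. if j \<in> {1..2*n} then x j - c / 2 else 0)"
  have opp: "x (star n j) = c - x j" if "j \<in> {1..2*n}" for j
    using c that by (metis add_diff_cancel_left')
  let ?C = "{x :: nat \<Rightarrow> real. iw_act (r, \<sigma>) x - x \<in> hull_orbit}"
  have "y \<in> ?C"
  proof (rule alcove_in_convex[OF n convex_displacement[OF convex_convex_hull]])
    show "y \<in> vecs n" by (auto simp: y_def vecs_def)
    show "y (star n j) = - y j" if "j \<in> {1..2*n}" for j
      using that star_in[OF that] opp[OF that] by (simp add: y_def)
    show "y i \<le> y (i + 1)" if "1 \<le> i" "i < n" for i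
    proof -
      have "i + 1 \<noteq> star n i" using that unfolding star_def by linarith
      then show ?thesis using wall[of i "i + 1"] that by (simp add: y_def)
    qed
    show "y (n - 1) + y n \<le> 0"
    proof -
      \<comment> \<open>As y changes sign under star, the alcove inequality for n - 1 and
        \<open>star n n\<close> bounds y (n - 1) + y n; likewise 1 and \<open>star n 2\<close> bound
        y 1 + y 2.\<close>
      have "n - 1 \<in> {1..2*n}" "star n n \<in> {1..2*n}" "n - 1 < star n n" "star n n \<noteq> star n (n - 1)"
        using n by (auto simp: star_def)
      from wall[OF this] show ?thesis using opp[of n] n by (auto simp: y_def)
    qed
    show "y 1 + y 2 \<ge> -1"
    proof -
      have "1 \<in> {1..2*n}" "star n 2 \<in> {1..2*n}" "1 < star n 2" "star n 2 \<noteq> star n 1"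
        using n by (auto simp: star_def)
      from wall[OF this] show ?thesis using opp[of 2] n by (auto simp: y_def)
    qed
    show "y 1 - y 2 \<ge> -1"
      using wall[of 1 2] n by (simp add: y_def star_def)
  qed (use n alcove_point_displacement_in_hull first_vertex_displacement_in_hull
      last_vertex_displacement_in_hull in auto)
  moreover have "iw_act (r, \<sigma>) x - x = iw_act (r, \<sigma>) y - y"
  proof
    fix j
    show "(iw_act (r, \<sigma>) x - x) j = (iw_act (r, \<sigma>) y - y) j"
    proof (cases "j \<in> {1..2*n}")
      case True
      then show ?thesis unfolding displacement_apply using tau_in[OF True] by (simp add: y_def)
    next
      case False
      then show ?thesis unfolding displacement_apply using tau_outside[OF False] by simp
    qed
  qed
  ultimately show ?thesis by simp
qed

section \<open>Distance of the hull from vertices of wrong parity\<close>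

text \<open>Half-spaces are convex; g is affine and not just linear because
  \<open>vertex_dist\<close> has a constant term.\<close>

lemma hull_affine_bound:
  fixes g :: "(nat \<Rightarrow> real) \<Rightarrow> real"
  assumes g: "\<And>x y u v. u + v = 1 \<Longrightarrow> g (u *\<^sub>R x + v *\<^sub>R y) = u * g x + v * g y"
    and S: "\<And>s. s \<in> S \<Longrightarrow> g s \<ge> c" and z: "z \<in> convex hull S"
  shows "g z \<ge> c"
proof -
  have "convex {x. g x \<ge> c}"
  proof (rule convexI)
    fix x y :: "nat \<Rightarrow> real" and u v :: real
    assume h: "x \<in> {x. g x \<ge> c}" "y \<in> {x. g x \<ge> c}" "0 \<le> u" "0 \<le> v" "u + v = 1"
    have "c = u * c + v * c" using h(5) by (metis distrib_right mult_1)
    also have "\<dots> \<le> u * g x + v * g y" using h by (intro add_mono mult_left_mono) auto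
    finally show "u *\<^sub>R x + v *\<^sub>R y \<in> {x. g x \<ge> c}" using g[OF h(5)] by simp
  qed
  then have "convex hull S \<subseteq> {x. g x \<ge> c}" using S by (intro hull_minimal) auto
  then show ?thesis using z by blast
qed

lemma hull_orbit_coordinate_bounds:
  assumes \<mu>: "binary_spinor n \<mu>" and z: "z \<in> convex hull (of_int_vec ` weyl0_orbit n \<mu>)"
    and j: "j \<in> {1..2*n}"
  shows "0 \<le> z j" "z j \<le> (1 :: real)"
proof -
  have s: "0 \<le> s j \<and> s j \<le> 1" if "s \<in> of_int_vec ` weyl0_orbit n \<mu>" for s :: "nat \<Rightarrow> real"
  proof -
    obtain m where m: "s = of_int_vec m" "m \<in> weyl0_orbit n \<mu>" using \<open>s \<in> _\<close> by blast
    then have "m j \<in> {0, 1}" using weyl0_orbit_iff[OF \<mu>] j unfolding binary_spinor_def by blast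
    then show ?thesis by (auto simp: m(1) of_int_vec_def)
  qed
  show "0 \<le> z j"
    by (rule hull_affine_bound[OF _ _ z, of "\<lambda>z. z j"]) (use s in \<open>auto simp: scaleR_fun_def\<close>)
  have "- 1 \<le> - z j"
    by (rule hull_affine_bound[OF _ _ z, of "\<lambda>z. - z j"]) (use s in \<open>auto simp: scaleR_fun_def\<close>)
  then show "z j \<le> 1" by simp
qed

text \<open>On the unit cube this is the \<open>\<ell>\<^sup>1\<close>-distance of the first \<open>n\<close> coordinates to the vertex \<open>u\<close>.\<close>

definition vertex_dist :: "nat \<Rightarrow> (nat \<Rightarrow> int) \<Rightarrow> (nat \<Rightarrow> real) \<Rightarrow> real" where
  "vertex_dist n u z = (\<Sum>j=1..n. of_int (u j) + (1 - 2 * of_int (u j)) * z j)"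

lemma vertex_dist_affine:
  assumes "a + b = 1"
  shows "vertex_dist n u (a *\<^sub>R x + b *\<^sub>R y) = a * vertex_dist n u x + b * vertex_dist n u y"
proof -
  have "of_int (u j) + (1 - 2 * of_int (u j)) * (a * x j + b * y j)
      = a * (of_int (u j) + (1 - 2 * of_int (u j)) * x j) + b * (of_int (u j) + (1 - 2 * of_int (u j)) * y j)"
    for j
  proof -
    have b: "b = 1 - a" using assms by simp
    show ?thesis unfolding b by (simp add: algebra_simps)
  qed
  then show ?thesis
    by (simp add: vertex_dist_def scaleR_fun_def sum_distrib_left flip: sum.distrib)
qed

text \<open>On an orbit vertex the distance counts the first-half positions differing from u;
  opposite parity makes this count odd, hence at least 1, and affinity extends the bound to the
  hull.\<close>

lemma vertex_dist_hull_ge_1: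
  assumes \<mu>: "binary_spinor n \<mu>" and u: "binary_spinor n u" "u \<notin> weyl0_orbit n \<mu>"
    and z: "z \<in> convex hull (of_int_vec ` weyl0_orbit n \<mu>)"
  shows "vertex_dist n u z \<ge> 1"
proof (rule hull_affine_bound[OF vertex_dist_affine _ z])
  fix s assume "s \<in> (of_int_vec ` weyl0_orbit n \<mu> :: (nat \<Rightarrow> real) set)"
  then obtain m where s: "s = of_int_vec m" and m: "m \<in> weyl0_orbit n \<mu>" by blast
  let ?d = "\<lambda>j. u j + (1 - 2 * u j) * m j"
  have bin: "u j \<in> {0, 1}" "m j \<in> {0, 1}" if "j \<in> {1..n}" for j
    using that u(1) m weyl0_orbit_iff[OF \<mu>] by (auto simp: binary_spinor_def)
  have parity: "odd ((\<Sum>j=1..n. u j) + (\<Sum>j=1..n. m j))"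
    using u m weyl0_orbit_iff[OF \<mu>] by auto
  have "(\<Sum>j=1..n. ?d j) = (\<Sum>j=1..n. u j) + (\<Sum>j=1..n. m j) - 2 * (\<Sum>j=1..n. u j * m j)"
    by (simp add: algebra_simps sum.distrib sum_subtractf sum_distrib_left)
  then have "odd (\<Sum>j=1..n. ?d j)" using parity by simp
  moreover have "(\<Sum>j=1..n. ?d j) \<ge> 0" by (rule sum_nonneg) (use bin in fastforce)
  ultimately have "(\<Sum>j=1..n. ?d j) \<ge> 1" by presburger
  then have "1 \<le> real_of_int (\<Sum>j=1..n. ?d j)" by linarith
  also have "\<dots> = vertex_dist n u s" by (simp add: vertex_dist_def s of_int_vec_def)
  finally show "1 \<le> vertex_dist n u s" .
qed

section \<open>Interior points of the base alcove\<close>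

text \<open>An explicit interior point; the denominator is the sum of j and \<open>star n j\<close>,
  so pair sums are 1. It pushes the points \<open>alcove_point n i\<close>, which satisfy the alcove
  inequalities only weakly, into the open alcove.\<close>

definition alcove_center :: "nat \<Rightarrow> nat \<Rightarrow> real" where
  "alcove_center n = (\<lambda>j. if j \<in> {1..2*n} then real j / (2 * real n + 1) else 0)"

lemma alcove_center_star:
  assumes "j \<in> {1..2*n}"
  shows "alcove_center n j + alcove_center n (star n j) = 1"
proof -
  have "real j + real (star n j) = 2 * real n + 1"
    using assms by (auto simp: star_def of_nat_diff)
  then show ?thesis
    using assms star_in[OF assms] by (simp add: alcove_center_def add_divide_distrib[symmetric])
qed

lemma alcove_center_diff:
  assumes "p \<in> {1..2*n}" "q \<in> {1..2*n}" "p < q"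
  shows "-1 < alcove_center n p - alcove_center n q" "alcove_center n p - alcove_center n q < 0"
  using assms by (simp_all add: alcove_center_def diff_divide_distrib[symmetric] field_simps)

lemma alcove_point_diff:
  assumes "p \<in> {1..2*n}" "q \<in> {1..2*n}" "p < q"
  shows "-1 \<le> alcove_point n i p - alcove_point n i q" "alcove_point n i p - alcove_point n i q \<le> 0"
  using assms by (auto simp: alcove_point_def omega_def star_def)

lemma alcove_center_in_base_alcove: "alcove_center n \<in> base_alcove n"
proof -
  have "alcove_center n \<in> vecs n" by (auto simp: alcove_center_def vecs_def)
  then show ?thesis
    using alcove_center_star alcove_center_diff by (auto simp: base_alcove_def cochars_iff)
qed

lemma alcove_mix_in_base_alcove:
  assumes t: "0 < t" "t < 1"
  shows "(1 - t) *\<^sub>R alcove_point n i + t *\<^sub>R alcove_center n \<in> base_alcove n"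
proof -
  define x where "x = (1 - t) *\<^sub>R alcove_point n i + t *\<^sub>R alcove_center n"
  have ap: "x j = (1 - t) * alcove_point n i j + t * alcove_center n j" for j
    by (simp add: x_def scaleR_fun_def)
  have "x j = 0" if "j \<notin> {1..2*n}" for j
    using that unfolding ap alcove_point_def alcove_center_def by (simp only: if_False)
  then have "x \<in> vecs n" by (simp add: vecs_def)
  moreover have "x j + x (star n j) = t" if "j \<in> {1..2*n}" for j
  proof -
    have "x j + x (star n j) = t * (alcove_center n j + alcove_center n (star n j))"
      unfolding ap alcove_point_antisym[OF that] by (simp only: algebra_simps)
    then show ?thesis using alcove_center_star[OF that] by simp
  qed
  moreover have "-1 < x p - x q \<and> x p - x q < 0" if pq: "p \<in> {1..2*n}" "q \<in> {1..2*n}" "p < q" for p q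
  proof -
    define a where "a = (1 - t) * (alcove_point n i p - alcove_point n i q)"
    define b where "b = t * (alcove_center n p - alcove_center n q)"
    have t': "0 \<le> 1 - t" using t by simp
    have "(1 - t) * (-1) \<le> a" "a \<le> (1 - t) * 0" "t * (-1) < b" "b < t * 0"
      unfolding a_def b_def using alcove_point_diff[OF pq] alcove_center_diff[OF pq] t t'
      by (intro mult_left_mono mult_strict_left_mono; blast)+
    moreover have "x p - x q = a + b" unfolding ap a_def b_def by (simp add: algebra_simps)
    ultimately show ?thesis by simp
  qed
  ultimately show ?thesis unfolding x_def[symmetric] base_alcove_def cochars_iff by blast
qed

section \<open>Comparison of the two permissible sets\<close>

lemma binary_spinor_mu1: "binary_spinor n (mu1 n)"
  by (auto simp: binary_spinor_def mu1_def vecs_def star_def)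

lemma binary_spinor_mu2: "n \<ge> 1 \<Longrightarrow> binary_spinor n (mu2 n)"
  by (auto simp: binary_spinor_def mu2_def vecs_def star_def)

text \<open>The spin conditions at 0 and n supply the congruence: the first fixes the parity of r,
  and the difference of the two half sums, the number of crossings, must be even.\<close>

lemma Perm_sp_subset_Perm:
  assumes n: "n \<ge> 2" and \<mu>: "binary_spinor n \<mu>"
  shows "Perm_sp n \<mu> \<subseteq> Perm n \<mu>"
proof
  fix w assume w: "w \<in> Perm_sp n \<mu>"
  obtain r \<sigma> where rs: "w = (r, \<sigma>)" by (cases w)
  have carrier: "(r, \<sigma>) \<in> carrier (iw_group n)" using w by (simp add: Perm_sp_def rs)
  have "gl_permissible_iw n r \<sigma>"
    using w n GL_permissible_iff[OF carrier] by (simp add: Perm_sp_def rs)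
  moreover have "spin_permissible_iw_axioms n r \<sigma> \<mu>"
    using w \<mu> by unfold_locales (auto simp: Perm_sp_def rs)
  ultimately interpret spin_permissible_iw n r \<sigma> \<mu>
    by (rule spin_permissible_iw.intro)
  have "r \<in> weyl0_orbit n \<mu>" "mu_vec (r, \<sigma>) n \<in> weyl0_orbit n \<mu>"
    using spin[OF _ totally_isotropic_0] spin[OF _ totally_isotropic_n] by (simp_all add: mu_vec_0)
  then have parity: "even (\<Sum>j=1..n. r j) \<longleftrightarrow> even (\<Sum>j=1..n. \<mu> j)"
    "even (\<Sum>j=1..n. mu_vec (r, \<sigma>) n j) \<longleftrightarrow> even (\<Sum>j=1..n. \<mu> j)"
    using weyl0_orbit_iff[OF \<mu>] by blast+
  then have "even (crossings n \<tau>)" unfolding mu_vec_n_half_sum by auto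
  then have "\<sigma> \<in> weyl0 n"
    using weyl by (simp add: weyl0_def evenperm_weyl_iff crossings_inv)
  then show "w \<in> Perm n \<mu>"
    using carrier coset_eq_transl_iff[OF \<mu> carrier] parity(1) r_star displacement_in_hull[OF n]
    by (simp add: Perm_def rs)
qed

text \<open>One interior point yields GL-permissibility, as coordinates on the hull lie in [0,1]. A
  totally isotropic \<open>mu_vec\<close> outside the orbit would be at distance at least 1 from the
  hull, but interior points near \<open>alcove_point n i\<close> have displacements closer to
  it.\<close>

lemma Perm_subset_Perm_sp:
  assumes n: "n \<ge> 1" and \<mu>: "binary_spinor n \<mu>"
  shows "Perm n \<mu> \<subseteq> Perm_sp n \<mu>"
proof
  fix w assume w: "w \<in> Perm n \<mu>"
  obtain r \<sigma> where rs: "w = (r, \<sigma>)" by (cases w)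
  let ?\<tau> = "inv_into UNIV \<sigma>"
  let ?hull = "convex hull (of_int_vec ` weyl0_orbit n \<mu>) :: (nat \<Rightarrow> real) set"
  have carrier: "(r, \<sigma>) \<in> carrier (iw_group n)" using w by (simp add: Perm_def rs)
  then have rw: "r \<in> vecs n" "\<sigma> \<in> weyl n" by (auto simp: iw_group_def cochars_def)
  have star_sum: "r j + r (star n j) = 1" if "j \<in> {1..2*n}" for j
    using w coset_eq_transl_iff[OF \<mu> carrier] that unfolding Perm_def rs by blast
  have hull: "iw_act (r, \<sigma>) x - x \<in> ?hull" if "x \<in> base_alcove n" for x
    using w that by (simp add: Perm_def rs)
  let ?z = "iw_act (r, \<sigma>) (alcove_center n) - alcove_center n"
  note z_hull = hull[OF alcove_center_in_base_alcove]
  have z: "0 \<le> ?z j" "?z j \<le> 1" if "j \<in> {1..2*n}" for j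
    using hull_orbit_coordinate_bounds[OF \<mu> z_hull that] by blast+
  have z_eq: "?z j = of_int (r j) + (alcove_center n (?\<tau> j) - alcove_center n j)" for j
    unfolding displacement_apply by simp
  have t: "?\<tau> j \<in> {1..2*n}" if "j \<in> {1..2*n}" for j
    by (rule weyl_in[OF weyl_inv[OF rw(2)] that])
  \<comment> \<open>Coordinates of the center differ by less than 1, so 0 \<le> \<open>?z j\<close>
    \<le> 1 leaves a single integer for r j.\<close>
  have descent: "r j = 1" if "j \<in> {1..2*n}" "?\<tau> j < j" for j
    using z[OF that(1)] alcove_center_diff[OF t[OF that(1)] that] unfolding z_eq by linarith
  have ascent: "r j = 0" if "j \<in> {1..2*n}" "?\<tau> j > j" for j
    using z[OF that(1)] alcove_center_diff[OF that(1) t[OF that(1)] that(2)] unfolding z_eq by linarith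
  have "r j \<in> {0, 1}" if j: "j \<in> {1..2*n}" for j
  proof (cases "?\<tau> j" j rule: linorder_cases)
    case equal
    then have "0 \<le> r j" "r j \<le> 1" using z[OF j] unfolding z_eq by simp_all
    then show ?thesis by auto
  qed (use descent ascent j in auto)
  then have "binary_spinor n r" using star_sum rw by (simp add: binary_spinor_def)
  then interpret gl_permissible_iw n r \<sigma>
    using rw descent ascent by unfold_locales auto
  have "mu_vec (r, \<sigma>) i \<in> weyl0_orbit n \<mu>"
    if i: "totally_isotropic n (mu_vec (r, \<sigma>) i)" for i
  proof (rule ccontr)
    let ?u = "mu_vec (r, \<sigma>) i"
    assume u: "?u \<notin> weyl0_orbit n \<mu>"
    let ?D = "vertex_dist n ?u"
    \<comment> \<open>The displacement of the center is at distance at most n from the vertex;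
      scaled by s this is at most n/(n+1) < 1.\<close>
    define s where "s = 1 / (real n + 1)"
    have s: "0 < s" "s < 1" using n by (simp_all add: s_def)
    let ?x = "(1 - s) *\<^sub>R alcove_point n i + s *\<^sub>R alcove_center n"
    have "iw_act (r, \<sigma>) ?x - ?x
        = (1 - s) *\<^sub>R (iw_act (r, \<sigma>) (alcove_point n i) - alcove_point n i) + s *\<^sub>R ?z"
    proof
      fix j
      show "(iw_act (r, \<sigma>) ?x - ?x) j
        = ((1 - s) *\<^sub>R (iw_act (r, \<sigma>) (alcove_point n i) - alcove_point n i) + s *\<^sub>R ?z) j"
        unfolding plus_fun_apply scaleR_fun_def displacement_apply by (simp add: algebra_simps)
    qed
    also have "iw_act (r, \<sigma>) (alcove_point n i) - alcove_point n i = of_int_vec ?u"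
      by (simp add: displacement_alcove_point isotropic_part_eq[OF mu_vec_in_vecs i])
    finally have mix: "iw_act (r, \<sigma>) ?x - ?x = (1 - s) *\<^sub>R of_int_vec ?u + s *\<^sub>R ?z" .
    have D_mix: "?D (iw_act (r, \<sigma>) ?x - ?x) = (1 - s) * ?D (of_int_vec ?u) + s * ?D ?z"
      unfolding mix by (rule vertex_dist_affine) simp
    have D_u: "?D (of_int_vec ?u) = 0"
      unfolding vertex_dist_def
    proof (rule sum.neutral, rule ballI)
      fix j assume "j \<in> {1..n}"
      then show "real_of_int (?u j) + (1 - 2 * real_of_int (?u j)) * of_int_vec ?u j = 0"
        using mu_vec_binary[of j i] by (auto simp: of_int_vec_def)
    qed
    have D_z: "?D ?z \<le> real n"
    proof -
      have "?D ?z \<le> (\<Sum>j=1..n. 1)"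
        unfolding vertex_dist_def
      proof (rule sum_mono)
        fix j assume "j \<in> {1..n}"
        then show "real_of_int (?u j) + (1 - 2 * real_of_int (?u j)) * ?z j \<le> 1"
          using mu_vec_binary[of j i] z[of j] by auto
      qed
      then show ?thesis by simp
    qed
    have "?D (iw_act (r, \<sigma>) ?x - ?x) \<le> s * real n"
      unfolding D_mix D_u using mult_left_mono[OF D_z, of s] s by simp
    also have "\<dots> < 1" by (simp add: s_def field_simps)
    finally have "?D (iw_act (r, \<sigma>) ?x - ?x) < 1" .
    moreover have "1 \<le> ?D (iw_act (r, \<sigma>) ?x - ?x)"
      using hull[OF alcove_mix_in_base_alcove[OF s]]
      by (rule vertex_dist_hull_ge_1[OF \<mu> totally_isotropic_spinor[OF i] u])
    ultimately show False by simp
  qed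
  then show "w \<in> Perm_sp n \<mu>"
    using carrier n GL_permissible_iff[OF carrier] gl_permissible_iw_axioms
    by (simp add: Perm_sp_def rs)
qed

theorem proposition8p8p1:
  fixes n :: nat and \<mu> :: "nat \<Rightarrow> int"
  assumes "n \<ge> 2" and "\<mu> \<in> {mu1 n, mu2 n}"
  shows "Perm_sp n \<mu> = Perm n \<mu>"
proof -
  have "binary_spinor n \<mu>" using assms binary_spinor_mu1 binary_spinor_mu2 by auto
  then show ?thesis
    using Perm_sp_subset_Perm Perm_subset_Perm_sp assms(1) by (metis One_nat_def Suc_1 Suc_leD subset_antisym)
qed

end
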